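(* Let $\mathcal C$ be a balanced factorization category such that for every object $X$ of $\mathcal C$ all discrete fibrations and all discrete opfibrations over $X$ are exponentiable in $\mathcal C/X$. Let $X$ be an object of $\mathcal C$ and $m\in\mathcal M/X$. Then the functor $\mathrm{ten}(m,-):\mathcal C/X\to\mathcal S$ has a right adjoint (the complement of $m$) $$\neg m:\mathcal S\to\mathcal C/X,\qquad S\mapsto (S\times X)^m,$$ and $\neg m$ takes values in $\mathcal M'/X$. Conversely (dually), the complement $S\mapsto(S\times X)^n$ of an $n\in\mathcal M'/X$ takes values in $\mathcal M/X$.
   Context: A balanced factorization category is a finitely complete category $\mathcal C$ with two (orthogonal) factorization systems $(\mathcal E,\mathcal M)$ and $(\mathcal E',\mathcal M')$ such that $\mathcal M/1=\mathcal M'/1$ (an object $S$ has $S\to 1$ in $\mathcal M$ iff in $\mathcal M'$), and such that the pullback of a map in $\mathcal E$ along a map in $\mathcal M'$ is in $\mathcal E$, and the pullback of a map in $\mathcal E'$ along a map in $\mathcal M$ is in $\mathcal E'$. Maps in $\mathcal M$ are called discrete fibrations and maps in $\mathcal M'$ discrete opfibrations. $\mathcal M/X$ (resp. $\mathcal M'/X$) is the full subcategory of $\mathcal C/X$ on the objects $A\to X$ in $\mathcal M$ (resp. $\mathcal M'$). $\mathcal S:=\mathcal M/1=\mathcal M'/1\hookrightarrow\mathcal C$ is the full subcategory of internal sets, reflective with reflection $\pi_0:\mathcal C\to\mathcal S$. For $p,q\in\mathcal C/X$, $\mathrm{ten}(p,q):=\pi_0(p\times_Xq)$, where $p\times_X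 q$ denotes the object of $\mathcal C$ underlying the product in $\mathcal C/X$. $S\times X$ is regarded as an object of $\mathcal C/X$ via the projection $S\times X\to X$, and $(-)^m$ denotes the right adjoint of $m\times-:\mathcal C/X\to\mathcal C/X$. *)

theory Defs
  imports Main
begin

section \<open>Categories and functors\<close>

record ('o, 'a) cat =
  Obj :: "'o set"
  Arr :: "'a set"
  Dom :: "'a \<Rightarrow> 'o"
  Cod :: "'a \<Rightarrow> 'o"
  Ident :: "'o \<Rightarrow> 'a"
  Comp :: "'a \<Rightarrow> 'a \<Rightarrow> 'a" (infixl "\<cdot>\<index>" 70)

definition hom :: "('o, 'a) cat \<Rightarrow> 'o \<Rightarrow> 'o \<Rightarrow> 'a set" where
  "hom C A B = {f \<in> Arr C. Dom C f = A \<and> Cod C f = B}"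

locale category =
  fixes C :: "('o, 'a) cat" (structure)
  assumes Dom_Obj: "f \<in> Arr C \<Longrightarrow> Dom C f \<in> Obj C"
    and Cod_Obj: "f \<in> Arr C \<Longrightarrow> Cod C f \<in> Obj C"
    and Ident_hom: "A \<in> Obj C \<Longrightarrow> Ident C A \<in> hom C A A"
    and Comp_hom: "f \<in> hom C A B \<Longrightarrow> g \<in> hom C B D \<Longrightarrow> g \<cdot> f \<in> hom C A D"
    and Comp_Ident: "f \<in> hom C A B \<Longrightarrow> f \<cdot> Ident C A = f"
    and Ident_Comp: "f \<in> hom C A B \<Longrightarrow> Ident C B \<cdot> f = f"
    and Comp_assoc: "f \<in> hom C A B \<Longrightarrow> g \<in> hom C B D \<Longrightarrow> h \<in> hom C D F \<Longrightarrow>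
          (h \<cdot> g) \<cdot> f = h \<cdot> (g \<cdot> f)"

definition full_subcat :: "('o, 'a) cat \<Rightarrow> 'o set \<Rightarrow> ('o, 'a) cat" where
  "full_subcat C U = C\<lparr>Obj := Obj C \<inter> U,
     Arr := {f \<in> Arr C. Dom C f \<in> U \<and> Cod C f \<in> U}\<rparr>"

text \<open>An arrow of the slice from p to q is a triple (p, f, q) with q \<cdot> f = p.\<close>

definition slice :: "('o, 'a) cat \<Rightarrow> 'o \<Rightarrow> ('a, 'a \<times> 'a \<times> 'a) cat" where
  "slice C X =
    \<lparr>Obj = {p \<in> Arr C. Cod C p = X},
     Arr = {(p, f, q). p \<in> Arr C \<and> Cod C p = X \<and> q \<in> Arr C \<and> Cod C q = X \<and>
                       f \<in> hom C (Dom C p) (Dom C q) \<and> q \<cdot>\<^bsub>C\<^esub> f = p},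
     Dom = (\<lambda>(p, f, q). p),
     Cod = (\<lambda>(p, f, q). q),
     Ident = (\<lambda>p. (p, Ident C (Dom C p), p)),
     Comp = (\<lambda>(q, g, r) (p, f, q'). (p, g \<cdot>\<^bsub>C\<^esub> f, r))\<rparr>"

record ('o, 'a, 'p, 'b) funct =
  fobj :: "'o \<Rightarrow> 'p"
  farr :: "'a \<Rightarrow> 'b"

definition is_functor :: "('o, 'a) cat \<Rightarrow> ('p, 'b) cat \<Rightarrow> ('o, 'a, 'p, 'b) funct \<Rightarrow> bool" where
  "is_functor C D F \<longleftrightarrow>
    (\<forall>A \<in> Obj C. fobj F A \<in> Obj D) \<and>
    (\<forall>A B. \<forall>f \<in> hom C A B. farr F f \<in> hom D (fobj F A) (fobj F B)) \<and>
    (\<forall>A \<in> Obj C. farr F (Ident C A) = Ident D (fobj F A)) \<and>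
    (\<forall>A B B'. \<forall>f \<in> hom C A B. \<forall>g \<in> hom C B B'.
        farr F (g \<cdot>\<^bsub>C\<^esub> f) = farr F g \<cdot>\<^bsub>D\<^esub> farr F f)"

definition inclusion :: "('o, 'a, 'o, 'a) funct" where
  "inclusion = \<lparr>fobj = (\<lambda>A. A), farr = (\<lambda>f. f)\<rparr>"

definition fcomp :: "('p, 'b, 'q, 'c) funct \<Rightarrow> ('o, 'a, 'p, 'b) funct \<Rightarrow> ('o, 'a, 'q, 'c) funct"
    (infixl "\<circ>\<^sub>F" 75) where
  "G \<circ>\<^sub>F F = \<lparr>fobj = (\<lambda>A. fobj G (fobj F A)), farr = (\<lambda>f. farr G (farr F f))\<rparr>"

text \<open>The domain functor on a slice of C; it is the same data for every base object.\<close>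

definition underlying :: "('o, 'a) cat \<Rightarrow> ('a, 'a \<times> 'a \<times> 'a, 'o, 'a) funct" where
  "underlying C = \<lparr>fobj = Dom C, farr = (\<lambda>(p, f, q). f)\<rparr>"

text \<open>F is the left adjoint.\<close>

definition adjoint ::
    "('o, 'a) cat \<Rightarrow> ('p, 'b) cat \<Rightarrow> ('o, 'a, 'p, 'b) funct \<Rightarrow> ('p, 'b, 'o, 'a) funct \<Rightarrow> bool" where
  "adjoint C D F G \<longleftrightarrow>
    is_functor C D F \<and> is_functor D C G \<and>
    (\<exists>\<phi>. (\<forall>A \<in> Obj C. \<forall>B \<in> Obj D.
            bij_betw (\<phi> A B) (hom D (fobj F A) B) (hom C A (fobj G B))) \<and>
         (\<forall>A \<in> Obj C. \<forall>A' \<in> Obj C. \<forall>B \<in> Obj D. \<forall>B' \<in> Obj D.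
          \<forall>f \<in> hom C A' A. \<forall>g \<in> hom D B B'. \<forall>h \<in> hom D (fobj F A) B.
            \<phi> A' B' (g \<cdot>\<^bsub>D\<^esub> h \<cdot>\<^bsub>D\<^esub> farr F f) = farr G g \<cdot>\<^bsub>C\<^esub> \<phi> A B h \<cdot>\<^bsub>C\<^esub> f))"

section \<open>Finite limits\<close>

definition is_cone :: "('j, 'k) cat \<Rightarrow> ('o, 'a) cat \<Rightarrow> ('j, 'k, 'o, 'a) funct \<Rightarrow>
    'o \<Rightarrow> ('j \<Rightarrow> 'a) \<Rightarrow> bool" where
  "is_cone J C F L \<pi> \<longleftrightarrow>
    L \<in> Obj C \<and> (\<forall>j \<in> Obj J. \<pi> j \<in> hom C L (fobj F j)) \<and>
    (\<forall>i j. \<forall>k \<in> hom J i j. farr F k \<cdot>\<^bsub>C\<^esub> \<pi> i = \<pi> j)"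

definition is_limit :: "('j, 'k) cat \<Rightarrow> ('o, 'a) cat \<Rightarrow> ('j, 'k, 'o, 'a) funct \<Rightarrow>
    'o \<Rightarrow> ('j \<Rightarrow> 'a) \<Rightarrow> bool" where
  "is_limit J C F L \<pi> \<longleftrightarrow>
    is_cone J C F L \<pi> \<and>
    (\<forall>K \<rho>. is_cone J C F K \<rho> \<longrightarrow>
       (\<exists>!h. h \<in> hom C K L \<and> (\<forall>j \<in> Obj J. \<pi> j \<cdot>\<^bsub>C\<^esub> h = \<rho> j)))"

text \<open>Every finite category is isomorphic to one whose objects and arrows are natural numbers,
  so the type of J loses no diagram shape.\<close>

definition finitely_complete :: "('o, 'a) cat \<Rightarrow> bool" where
  "finitely_complete C \<longleftrightarrow>
    (\<forall>(J :: (nat, nat) cat) F.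
       category J \<and> finite (Obj J) \<and> finite (Arr J) \<and> is_functor J C F \<longrightarrow>
       (\<exists>L \<pi>. is_limit J C F L \<pi>))"

definition is_terminal :: "('o, 'a) cat \<Rightarrow> 'o \<Rightarrow> bool" where
  "is_terminal C T \<longleftrightarrow> T \<in> Obj C \<and> (\<forall>A \<in> Obj C. \<exists>!f. f \<in> hom C A T)"

definition terminal :: "('o, 'a) cat \<Rightarrow> 'o" where
  "terminal C = (SOME T. is_terminal C T)"

definition is_pullback :: "('o, 'a) cat \<Rightarrow> 'a \<Rightarrow> 'a \<Rightarrow> 'o \<Rightarrow> 'a \<Rightarrow> 'a \<Rightarrow> bool" where
  "is_pullback C f g P p q \<longleftrightarrow>
    f \<in> Arr C \<and> g \<in> Arr C \<and> Cod C f = Cod C g \<and> P \<in> Obj C \<and>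
    p \<in> hom C P (Dom C f) \<and> q \<in> hom C P (Dom C g) \<and> f \<cdot>\<^bsub>C\<^esub> p = g \<cdot>\<^bsub>C\<^esub> q \<and>
    (\<forall>K \<in> Obj C. \<forall>u \<in> hom C K (Dom C f). \<forall>v \<in> hom C K (Dom C g).
       f \<cdot>\<^bsub>C\<^esub> u = g \<cdot>\<^bsub>C\<^esub> v \<longrightarrow>
       (\<exists>!h. h \<in> hom C K P \<and> p \<cdot>\<^bsub>C\<^esub> h = u \<and> q \<cdot>\<^bsub>C\<^esub> h = v))"

definition is_product :: "('o, 'a) cat \<Rightarrow> 'o \<Rightarrow> 'o \<Rightarrow> 'o \<Rightarrow> 'a \<Rightarrow> 'a \<Rightarrow> bool" where
  "is_product C A B P p q \<longleftrightarrow>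
    P \<in> Obj C \<and> p \<in> hom C P A \<and> q \<in> hom C P B \<and>
    (\<forall>K \<in> Obj C. \<forall>u \<in> hom C K A. \<forall>v \<in> hom C K B.
       \<exists>!h. h \<in> hom C K P \<and> p \<cdot>\<^bsub>C\<^esub> h = u \<and> q \<cdot>\<^bsub>C\<^esub> h = v)"

text \<open>Products, the terminal object, the powers and the reflection are arbitrary fixed choices;
  each is determined up to unique isomorphism where it exists.\<close>

definition product :: "('o, 'a) cat \<Rightarrow> 'o \<Rightarrow> 'o \<Rightarrow> 'o \<times> 'a \<times> 'a" where
  "product C A B = (SOME (P, p, q). is_product C A B P p q)"

definition prod_obj :: "('o, 'a) cat \<Rightarrow> 'o \<Rightarrow> 'o \<Rightarrow> 'o" where
  "prod_obj C A B = fst (product C A B)"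

definition pr1 :: "('o, 'a) cat \<Rightarrow> 'o \<Rightarrow> 'o \<Rightarrow> 'a" where
  "pr1 C A B = fst (snd (product C A B))"

definition pr2 :: "('o, 'a) cat \<Rightarrow> 'o \<Rightarrow> 'o \<Rightarrow> 'a" where
  "pr2 C A B = snd (snd (product C A B))"

definition pairing :: "('o, 'a) cat \<Rightarrow> 'o \<Rightarrow> 'o \<Rightarrow> 'a \<Rightarrow> 'a \<Rightarrow> 'a" where
  "pairing C A B u v = (THE h. h \<in> hom C (Dom C u) (prod_obj C A B) \<and>
     pr1 C A B \<cdot>\<^bsub>C\<^esub> h = u \<and> pr2 C A B \<cdot>\<^bsub>C\<^esub> h = v)"

text \<open>The functor A \<times> (-).\<close>

definition product_functor :: "('o, 'a) cat \<Rightarrow> 'o \<Rightarrow> ('o, 'a, 'o, 'a) funct" where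
  "product_functor C A =
    \<lparr>fobj = (\<lambda>B. prod_obj C A B),
     farr = (\<lambda>f. pairing C A (Cod C f) (pr1 C A (Dom C f)) (f \<cdot>\<^bsub>C\<^esub> pr2 C A (Dom C f)))\<rparr>"

definition exponentiable :: "('o, 'a) cat \<Rightarrow> 'o \<Rightarrow> bool" where
  "exponentiable C A \<longleftrightarrow> A \<in> Obj C \<and> (\<exists>G. adjoint C C (product_functor C A) G)"

text \<open>The functor (-)^A.\<close>

definition power_functor :: "('o, 'a) cat \<Rightarrow> 'o \<Rightarrow> ('o, 'a, 'o, 'a) funct" where
  "power_functor C A = (SOME G. adjoint C C (product_functor C A) G)"

text \<open>The functor to the slice over X that takes A to the projection A \<times> X \<rightarrow> X.\<close>

definition times_over :: "('o, 'a) cat \<Rightarrow> 'o \<Rightarrow> ('o, 'a, 'a, 'a \<times> 'a \<times> 'a) funct" where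
  "times_over C X =
    \<lparr>fobj = (\<lambda>A. pr2 C A X),
     farr = (\<lambda>f. (pr2 C (Dom C f) X,
                  pairing C (Cod C f) X (f \<cdot>\<^bsub>C\<^esub> pr1 C (Dom C f) X) (pr2 C (Dom C f) X),
                  pr2 C (Cod C f) X))\<rparr>"

section \<open>Balanced factorization categories\<close>

definition orthogonal :: "('o, 'a) cat \<Rightarrow> 'a \<Rightarrow> 'a \<Rightarrow> bool" where
  "orthogonal C e m \<longleftrightarrow>
    (\<forall>u \<in> hom C (Dom C e) (Dom C m). \<forall>v \<in> hom C (Cod C e) (Cod C m).
       m \<cdot>\<^bsub>C\<^esub> u = v \<cdot>\<^bsub>C\<^esub> e \<longrightarrow>
       (\<exists>!d. d \<in> hom C (Cod C e) (Dom C m) \<and> d \<cdot>\<^bsub>C\<^esub> e = u \<and> m \<cdot>\<^bsub>C\<^esub> d = v))"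

definition factorization_system :: "('o, 'a) cat \<Rightarrow> 'a set \<Rightarrow> 'a set \<Rightarrow> bool" where
  "factorization_system C E M \<longleftrightarrow>
    E = {e \<in> Arr C. \<forall>m \<in> M. orthogonal C e m} \<and>
    M = {m \<in> Arr C. \<forall>e \<in> E. orthogonal C e m} \<and>
    (\<forall>f \<in> Arr C. \<exists>e \<in> E. \<exists>m \<in> M. Cod C e = Dom C m \<and> f = m \<cdot>\<^bsub>C\<^esub> e)"

text \<open>The category M/X.\<close>

definition over :: "('o, 'a) cat \<Rightarrow> 'a set \<Rightarrow> 'o \<Rightarrow> ('a, 'a \<times> 'a \<times> 'a) cat" where
  "over C M X = full_subcat (slice C X) M"

text \<open>The category M/1, as a full subcategory of C.\<close>

definition internal_sets :: "('o, 'a) cat \<Rightarrow> 'a set \<Rightarrow> ('o, 'a) cat" where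
  "internal_sets C M = full_subcat C {S. \<exists>f \<in> hom C S (terminal C). f \<in> M}"

locale balanced_factorization_category = category C
  for C :: "('o, 'a) cat" (structure) +
  fixes E M E' M' :: "'a set"
  assumes complete: "finitely_complete C"
    and fact: "factorization_system C E M"
    and fact': "factorization_system C E' M'"
    and same_internal_sets: "Obj (internal_sets C M) = Obj (internal_sets C M')"
    and pullback_E: "e \<in> E \<Longrightarrow> f \<in> M' \<Longrightarrow> is_pullback C e f P p q \<Longrightarrow> q \<in> E"
    and pullback_E': "e \<in> E' \<Longrightarrow> f \<in> M \<Longrightarrow> is_pullback C e f P p q \<Longrightarrow> q \<in> E'"

definition pi0 :: "('o, 'a) cat \<Rightarrow> 'a set \<Rightarrow> ('o, 'a, 'o, 'a) funct" where
  "pi0 C M = (SOME R. adjoint C (internal_sets C M) R inclusion)"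

text \<open>The functor ten(p, -) from C/X to internal sets.\<close>

definition ten :: "('o, 'a) cat \<Rightarrow> 'a set \<Rightarrow> 'o \<Rightarrow> 'a \<Rightarrow> ('a, 'a \<times> 'a \<times> 'a, 'o, 'a) funct" where
  "ten C M X p = pi0 C M \<circ>\<^sub>F underlying C \<circ>\<^sub>F product_functor (slice C X) p"

text \<open>The functor from internal sets to C/X that takes S to the exponential of S \<times> X by p.\<close>

definition complement :: "('o, 'a) cat \<Rightarrow> 'o \<Rightarrow> 'a \<Rightarrow> ('o, 'a, 'a, 'a \<times> 'a \<times> 'a) funct" where
  "complement C X p = power_functor (slice C X) p \<circ>\<^sub>F times_over C X \<circ>\<^sub>F inclusion"

end

theory Submission
  imports Defs
begin

text \<open>The functor ten(m, -) is the composite of the left adjoints \<open>m \<times> -\<close> on C/X, the domain functor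
  and the reflection, so the composite of the right adjoints is the complement.  By transposition,
  a map e of E' over X is orthogonal to the exponential of \<open>S \<times> X\<close> by m iff \<open>m \<times> e\<close> is orthogonal
  to the map from S to 1.  Now \<open>m \<times> e\<close> is the pullback of e along a pullback of m, so it lies in E',
  and S to 1 lies in M' because S is an internal set.  The other half is the same argument for the
  balanced factorization category with the two systems interchanged.\<close>

section \<open>Adjunctions\<close>

text \<open>Orthogonality and adjunction meet once both are phrased on hom-sets. In C/X, a square
  from \<open>e\<close> to \<open>r\<close> with lower edge \<open>v\<close> is an arrow from
  \<open>v \<cdot> e\<close> to \<open>r\<close>, and a filler is an arrow from \<open>v\<close> to
  \<open>r\<close>; so \<open>e\<close> is orthogonal to \<open>r\<close> when, for every
  \<open>v\<close>, precomposition with \<open>e\<close> is a bijection between these two hom-sets.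
  In C, a square from \<open>k\<close> to S \<rightarrow> 1 is just an arrow into S, since all
  arrows into 1 agree, and orthogonality is again bijectivity of precomposition. Naturality of the
  transposition carries one bijection to the other, so the exponential enters only through its
  adjunction. This suits the definitions, where products, powers and the reflection are arbitrary
  choices. Two composites of adjunctions occur: the full one for \<open>ten\<close>, and one that
  stops in C, where the lifting problems against S \<rightarrow> 1 are posed. In both halves
  \<open>ten\<close> uses the reflection of (E, M), so only the membership claim is dualized by
  interchanging the systems.\<close>

lemma homI: "f \<in> Arr C \<Longrightarrow> f \<in> hom C (Dom C f) (Cod C f)"
  by (simp add: hom_def)

lemma hom_Dom: "f \<in> hom C A B \<Longrightarrow> Dom C f = A"
  and hom_Cod: "f \<in> hom C A B \<Longrightarrow> Cod C f = B"
  and hom_Arr: "f \<in> hom C A B \<Longrightarrow> f \<in> Arr C"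
  by (simp_all add: hom_def)

lemma fcomp_assoc: "H \<circ>\<^sub>F (G \<circ>\<^sub>F F) = (H \<circ>\<^sub>F G) \<circ>\<^sub>F F"
  by (simp add: fcomp_def)

lemma is_functor_fcomp:
  assumes "is_functor C D F" "is_functor D B G"
  shows "is_functor C B (G \<circ>\<^sub>F F)"
  using assms unfolding is_functor_def fcomp_def
  by simp metis

lemma adjoint_fcomp:
  assumes 1: "adjoint C D F G" and 2: "adjoint D B F' G'"
  shows "adjoint C B (F' \<circ>\<^sub>F F) (G \<circ>\<^sub>F G')"
proof -
  from 1 obtain \<phi> where F: "is_functor C D F" and G: "is_functor D C G"
    and bij: "\<And>A B. A \<in> Obj C \<Longrightarrow> B \<in> Obj D \<Longrightarrow>
            bij_betw (\<phi> A B) (hom D (fobj F A) B) (hom C A (fobj G B))"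
    and nat: "\<And>A A' B B' f g h. A \<in> Obj C \<Longrightarrow> A' \<in> Obj C \<Longrightarrow> B \<in> Obj D \<Longrightarrow> B' \<in> Obj D \<Longrightarrow>
          f \<in> hom C A' A \<Longrightarrow> g \<in> hom D B B' \<Longrightarrow> h \<in> hom D (fobj F A) B \<Longrightarrow>
            \<phi> A' B' (g \<cdot>\<^bsub>D\<^esub> h \<cdot>\<^bsub>D\<^esub> farr F f) = farr G g \<cdot>\<^bsub>C\<^esub> \<phi> A B h \<cdot>\<^bsub>C\<^esub> f"
    unfolding adjoint_def by metis
  from 2 obtain \<psi> where F': "is_functor D B F'" and G': "is_functor B D G'"
    and bij': "\<And>A S. A \<in> Obj D \<Longrightarrow> S \<in> Obj B \<Longrightarrow>
            bij_betw (\<psi> A S) (hom B (fobj F' A) S) (hom D A (fobj G' S))"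
    and nat': "\<And>A A' S S' f g h. A \<in> Obj D \<Longrightarrow> A' \<in> Obj D \<Longrightarrow> S \<in> Obj B \<Longrightarrow> S' \<in> Obj B \<Longrightarrow>
          f \<in> hom D A' A \<Longrightarrow> g \<in> hom B S S' \<Longrightarrow> h \<in> hom B (fobj F' A) S \<Longrightarrow>
            \<psi> A' S' (g \<cdot>\<^bsub>B\<^esub> h \<cdot>\<^bsub>B\<^esub> farr F' f) = farr G' g \<cdot>\<^bsub>D\<^esub> \<psi> A S h \<cdot>\<^bsub>D\<^esub> f"
    unfolding adjoint_def by metis
  \<comment> \<open>The two transpositions meet at the arrows of D from \<open>fobj F A\<close> to
    \<open>fobj G' S\<close>.\<close>
  let ?\<chi> = "\<lambda>A S. \<phi> A (fobj G' S) \<circ> \<psi> (fobj F A) S"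
  have FO: "fobj F A \<in> Obj D" if "A \<in> Obj C" for A
    using F that by (simp add: is_functor_def)
  have FA: "farr F f \<in> hom D (fobj F A) (fobj F A')" if "f \<in> hom C A A'" for f A A'
    using F that by (simp add: is_functor_def)
  have GO: "fobj G' S \<in> Obj D" if "S \<in> Obj B" for S
    using G' that by (simp add: is_functor_def)
  have GA: "farr G' f \<in> hom D (fobj G' S) (fobj G' S')" if "f \<in> hom B S S'" for f S S'
    using G' that by (simp add: is_functor_def)
  have "bij_betw (?\<chi> A S) (hom B (fobj (F' \<circ>\<^sub>F F) A) S) (hom C A (fobj (G \<circ>\<^sub>F G') S))"
    if "A \<in> Obj C" "S \<in> Obj B" for A S
    using bij_betw_trans[OF bij'[OF FO[OF that(1)] that(2)] bij[OF that(1) GO[OF that(2)]]]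
    by (simp add: fcomp_def)
  moreover have "?\<chi> A' S' (g \<cdot>\<^bsub>B\<^esub> h \<cdot>\<^bsub>B\<^esub> farr (F' \<circ>\<^sub>F F) f)
      = farr (G \<circ>\<^sub>F G') g \<cdot>\<^bsub>C\<^esub> ?\<chi> A S h \<cdot>\<^bsub>C\<^esub> f"
    if "A \<in> Obj C" "A' \<in> Obj C" "S \<in> Obj B" "S' \<in> Obj B"
      "f \<in> hom C A' A" "g \<in> hom B S S'" "h \<in> hom B (fobj (F' \<circ>\<^sub>F F) A) S" for A A' S S' f g h
  proof -
    have h: "h \<in> hom B (fobj F' (fobj F A)) S"
      using that(7) by (simp add: fcomp_def)
    have "\<psi> (fobj F A) S h \<in> hom D (fobj F A) (fobj G' S)"
      using bij'[OF FO[OF that(1)] that(3)] h by (auto simp: bij_betw_def)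
    then show ?thesis
      using nat'[OF FO[OF that(1)] FO[OF that(2)] that(3,4) FA[OF that(5)] that(6) h]
        nat[OF that(1,2) GO[OF that(3)] GO[OF that(4)] that(5) GA[OF that(6)]]
      by (simp add: fcomp_def)
  qed
  ultimately show ?thesis
    unfolding adjoint_def using is_functor_fcomp[OF F F'] is_functor_fcomp[OF G' G]
    by (intro conjI exI[of _ ?\<chi>] ballI) auto
qed

text \<open>Naturality in the contravariant variable conjugates precomposition with
  \<open>farr F f\<close> into precomposition with \<open>f\<close>. This is the form in which
  unique lifting crosses an adjunction.\<close>

lemma adjoint_precomp_bij:
  assumes C: "category C" and D: "category D" and adj: "adjoint C D F G"
    and f: "f \<in> hom C A' A" and B: "B \<in> Obj D"
    and bij: "bij_betw (\<lambda>h. h \<cdot>\<^bsub>D\<^esub> farr F f) (hom D (fobj F A) B) (hom D (fobj F A') B)"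
  shows "bij_betw (\<lambda>h. h \<cdot>\<^bsub>C\<^esub> f) (hom C A (fobj G B)) (hom C A' (fobj G B))"
proof -
  interpret C: category C by fact
  interpret D: category D by fact
  from adj obtain \<phi> where F: "is_functor C D F" and G: "is_functor D C G"
    and bijs: "\<And>A B. A \<in> Obj C \<Longrightarrow> B \<in> Obj D \<Longrightarrow>
            bij_betw (\<phi> A B) (hom D (fobj F A) B) (hom C A (fobj G B))"
    and nat: "\<And>A A' B B' f g h. A \<in> Obj C \<Longrightarrow> A' \<in> Obj C \<Longrightarrow> B \<in> Obj D \<Longrightarrow> B' \<in> Obj D \<Longrightarrow>
          f \<in> hom C A' A \<Longrightarrow> g \<in> hom D B B' \<Longrightarrow> h \<in> hom D (fobj F A) B \<Longrightarrow>
            \<phi> A' B' (g \<cdot>\<^bsub>D\<^esub> h \<cdot>\<^bsub>D\<^esub> farr F f) = farr G g \<cdot>\<^bsub>C\<^esub> \<phi> A B h \<cdot>\<^bsub>C\<^esub> f"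
    unfolding adjoint_def by metis
  have A: "A \<in> Obj C" and A': "A' \<in> Obj C"
    using f C.Dom_Obj C.Cod_Obj by (auto simp: hom_def)
  \<comment> \<open>Naturality is given jointly in both variables; the identity of \<open>B\<close>
    isolates the variable \<open>A\<close>.\<close>
  have nat1: "\<phi> A' B (h \<cdot>\<^bsub>D\<^esub> farr F f) = \<phi> A B h \<cdot>\<^bsub>C\<^esub> f" if h: "h \<in> hom D (fobj F A) B" for h
  proof -
    have "\<phi> A B h \<in> hom C A (fobj G B)"
      using bijs[OF A B] h by (auto simp: bij_betw_def)
    moreover have "farr G (Ident D B) = Ident C (fobj G B)"
      using G B by (simp add: is_functor_def)
    ultimately show ?thesis
      using nat[OF A A' B B f D.Ident_hom[OF B] h] by (simp add: D.Ident_Comp[OF h] C.Ident_Comp)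
  qed
  let ?\<psi> = "inv_into (hom D (fobj F A) B) (\<phi> A B)"
  have "bij_betw (\<phi> A' B \<circ> (\<lambda>h. h \<cdot>\<^bsub>D\<^esub> farr F f) \<circ> ?\<psi>) (hom C A (fobj G B)) (hom C A' (fobj G B))"
    by (rule bij_betw_trans[OF bij_betw_inv_into[OF bijs[OF A B]]
          bij_betw_trans[OF bij bijs[OF A' B]]])
  moreover have "(\<phi> A' B \<circ> (\<lambda>h. h \<cdot>\<^bsub>D\<^esub> farr F f) \<circ> ?\<psi>) k = k \<cdot>\<^bsub>C\<^esub> f"
    if "k \<in> hom C A (fobj G B)" for k
  proof -
    have "?\<psi> k \<in> hom D (fobj F A) B" "\<phi> A B (?\<psi> k) = k"
      using bijs[OF A B] that
      by (metis bij_betw_imp_surj_on inv_into_into, metis bij_betw_inv_into_right)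
    then show ?thesis
      using nat1 by simp
  qed
  ultimately show ?thesis
    by (subst bij_betw_cong[symmetric]) auto
qed

section \<open>Slices\<close>

lemma hom_slice:
  "h \<in> hom (slice C X) p q \<longleftrightarrow>
    (\<exists>f. h = (p, f, q) \<and> p \<in> Arr C \<and> Cod C p = X \<and> q \<in> Arr C \<and> Cod C q = X \<and>
         f \<in> hom C (Dom C p) (Dom C q) \<and> q \<cdot>\<^bsub>C\<^esub> f = p)"
  by (auto simp: hom_def slice_def)

lemma slice_homI:
  "p \<in> hom C A X \<Longrightarrow> q \<in> hom C B X \<Longrightarrow> f \<in> hom C A B \<Longrightarrow> q \<cdot>\<^bsub>C\<^esub> f = p \<Longrightarrow>
    (p, f, q) \<in> hom (slice C X) p q"
  by (subst hom_slice) (simp add: hom_def)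

lemma Obj_slice: "p \<in> Obj (slice C X) \<longleftrightarrow> p \<in> Arr C \<and> Cod C p = X"
  by (simp add: slice_def)

lemma Comp_slice [simp]: "(q, g, r) \<cdot>\<^bsub>slice C X\<^esub> (p, f, q') = (p, g \<cdot>\<^bsub>C\<^esub> f, r)"
  by (simp add: slice_def)

lemma Ident_slice [simp]: "Ident (slice C X) p = (p, Ident C (Dom C p), p)"
  by (simp add: slice_def)

lemma hom_full_subcat: "f \<in> hom (full_subcat C U) A B \<longleftrightarrow> f \<in> hom C A B \<and> A \<in> U \<and> B \<in> U"
  by (auto simp: hom_def full_subcat_def)

lemma full_subcat_simps [simp]:
  "A \<in> Obj (full_subcat C U) \<longleftrightarrow> A \<in> Obj C \<and> A \<in> U"
  "Comp (full_subcat C U) = Comp C"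
  "Ident (full_subcat C U) = Ident C"
  by (simp_all add: full_subcat_def)

lemma Obj_over: "p \<in> Obj (over C M X) \<longleftrightarrow> p \<in> Arr C \<and> Cod C p = X \<and> p \<in> M"
  by (simp add: over_def full_subcat_def slice_def)

context category
begin

lemma hom_Obj: "f \<in> hom C A B \<Longrightarrow> A \<in> Obj C" "f \<in> hom C A B \<Longrightarrow> B \<in> Obj C"
  using Dom_Obj Cod_Obj by (auto simp: hom_def)

lemma slice_homE:
  assumes "h \<in> hom (slice C X) p q"
  obtains f where "h = (p, f, q)" "p \<in> hom C (Dom C p) X" "q \<in> hom C (Dom C q) X"
    "f \<in> hom C (Dom C p) (Dom C q)" "q \<cdot> f = p"
proof -
  obtain f where "h = (p, f, q)" "p \<in> Arr C" "Cod C p = X" "q \<in> Arr C" "Cod C q = X"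
    "f \<in> hom C (Dom C p) (Dom C q)" "q \<cdot> f = p"
    using assms unfolding hom_slice by (elim exE conjE)
  then show thesis
    using that[of f] homI[of p C] homI[of q C] by simp
qed

lemma category_slice: "category (slice C X)"
proof
  fix f assume "f \<in> Arr (slice C X)"
  then show "Dom (slice C X) f \<in> Obj (slice C X)" "Cod (slice C X) f \<in> Obj (slice C X)"
    by (auto simp: slice_def)
next
  fix p assume "p \<in> Obj (slice C X)"
  then have p: "p \<in> hom C (Dom C p) X"
    using homI[of p C] by (simp add: Obj_slice)
  show "Ident (slice C X) p \<in> hom (slice C X) p p"
    unfolding Ident_slice by (rule slice_homI[OF p p Ident_hom[OF hom_Obj(1)[OF p]] Comp_Ident[OF p]])
next
  fix f p q assume f: "f \<in> hom (slice C X) p q"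
  obtain f' where f': "f = (p, f', q)" "f' \<in> hom C (Dom C p) (Dom C q)"
    and p: "p \<in> hom C (Dom C p) X" and f'_over: "q \<cdot> f' = p"
    by (rule slice_homE[OF f])
  show "f \<cdot>\<^bsub>slice C X\<^esub> Ident (slice C X) p = f" "Ident (slice C X) q \<cdot>\<^bsub>slice C X\<^esub> f = f"
    by (simp_all add: f'(1) Comp_Ident[OF f'(2)] Ident_Comp[OF f'(2)])
  fix g r assume g: "g \<in> hom (slice C X) q r"
  obtain g' where g': "g = (q, g', r)" "g' \<in> hom C (Dom C q) (Dom C r)"
    and r: "r \<in> hom C (Dom C r) X" and g'_over: "r \<cdot> g' = q"
    by (rule slice_homE[OF g])
  have "r \<cdot> (g' \<cdot> f') = p"
    using Comp_assoc[OF f'(2) g'(2) r] f'_over g'_over by simp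
  then show "g \<cdot>\<^bsub>slice C X\<^esub> f \<in> hom (slice C X) p r"
    using slice_homI[OF p r Comp_hom[OF f'(2) g'(2)]] by (simp add: f'(1) g'(1))
  fix h s assume h: "h \<in> hom (slice C X) r s"
  obtain h' where h': "h = (r, h', s)" "h' \<in> hom C (Dom C r) (Dom C s)"
    by (rule slice_homE[OF h])
  show "h \<cdot>\<^bsub>slice C X\<^esub> g \<cdot>\<^bsub>slice C X\<^esub> f = h \<cdot>\<^bsub>slice C X\<^esub> (g \<cdot>\<^bsub>slice C X\<^esub> f)"
    by (simp add: f'(1) g'(1) h'(1) Comp_assoc[OF f'(2) g'(2) h'(2)])
qed

section \<open>Limits\<close>

text \<open>The choice satisfies the universal property as soon as any product exists, so existence
  is all that has to be proved about it.\<close>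

lemma product_is_product:
  assumes "is_product C A B P p q"
  shows "is_product C A B (prod_obj C A B) (pr1 C A B) (pr2 C A B)"
proof -
  have "case product C A B of (P, p, q) \<Rightarrow> is_product C A B P p q"
    unfolding product_def by (rule someI[of _ "(P, p, q)"]) (simp add: assms)
  then show ?thesis
    by (simp add: prod_obj_def pr1_def pr2_def split_beta)
qed

lemma pairing_eqI:
  assumes "is_product C A B (prod_obj C A B) (pr1 C A B) (pr2 C A B)"
    and "h \<in> hom C K (prod_obj C A B)" "pr1 C A B \<cdot> h = u" "pr2 C A B \<cdot> h = v"
    and "u \<in> hom C K A" "v \<in> hom C K B"
  shows "pairing C A B u v = h"
  unfolding pairing_def
proof (rule the_equality)
  show "h \<in> hom C (Dom C u) (prod_obj C A B) \<and> pr1 C A B \<cdot> h = u \<and> pr2 C A B \<cdot> h = v"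
    using assms by (simp add: hom_Dom)
  fix k assume "k \<in> hom C (Dom C u) (prod_obj C A B) \<and> pr1 C A B \<cdot> k = u \<and> pr2 C A B \<cdot> k = v"
  moreover have "K \<in> Obj C"
    using assms(5) hom_Obj by blast
  ultimately show "k = h"
    using assms unfolding is_product_def by (metis hom_Dom)
qed

lemma pairing_props:
  assumes "is_product C A B (prod_obj C A B) (pr1 C A B) (pr2 C A B)"
    and "u \<in> hom C K A" "v \<in> hom C K B"
  shows "pairing C A B u v \<in> hom C K (prod_obj C A B)"
    and "pr1 C A B \<cdot> pairing C A B u v = u"
    and "pr2 C A B \<cdot> pairing C A B u v = v"
proof -
  have "K \<in> Obj C"
    using assms(2) hom_Obj by blast
  then obtain h where "h \<in> hom C K (prod_obj C A B)" "pr1 C A B \<cdot> h = u" "pr2 C A B \<cdot> h = v"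
    using assms unfolding is_product_def by metis
  then show "pairing C A B u v \<in> hom C K (prod_obj C A B)"
    "pr1 C A B \<cdot> pairing C A B u v = u" "pr2 C A B \<cdot> pairing C A B u v = v"
    using pairing_eqI[OF assms(1) _ _ _ assms(2,3)] by auto
qed

text \<open>A cone on \<open>f\<close> and \<open>g\<close> in the slice is a commuting square whose
  diagonal is the structure map. Both directions matter: pullbacks produce slice products, and the
  chosen slice product is read back as a pullback.\<close>

lemma slice_product_iff_pullback:
  assumes "f \<in> Arr C" "Cod C f = X" "g \<in> Arr C" "Cod C g = X"
    and "p \<in> hom C P (Dom C f)" "q \<in> hom C P (Dom C g)" "f \<cdot> p = r" "g \<cdot> q = r"
  shows "is_product (slice C X) f g r (r, p, f) (r, q, g) \<longleftrightarrow> is_pullback C f g P p q"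
proof -
  have r: "r \<in> hom C P X"
    using assms Comp_hom[OF assms(5), of f] homI[of f C] by auto
  have PO: "P \<in> Obj C" and DP: "Dom C r = P"
    using r hom_Obj hom_Dom by auto
  have proj: "(r, p, f) \<in> hom (slice C X) r f" "(r, q, g) \<in> hom (slice C X) r g"
    "r \<in> Obj (slice C X)"
    using slice_homI[OF r homI[of f C, unfolded assms(2)] assms(5,7)]
      slice_homI[OF r homI[of g C, unfolded assms(4)] assms(6,8)] assms r by (auto simp: Obj_slice hom_Arr hom_Cod)
  \<comment> \<open>A mediating arrow lies over X automatically: \<open>r\<close> factors through
    \<open>p\<close>, so its composite with \<open>h\<close> is fixed by \<open>u\<close>.\<close>
  have rh: "r \<cdot> h = f \<cdot> u" if "h \<in> hom C K P" "p \<cdot> h = u" for h K u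
    using Comp_assoc[OF that(1) assms(5) homI[OF assms(1)]] that assms by simp
  show ?thesis
  proof
    assume prod: "is_product (slice C X) f g r (r, p, f) (r, q, g)"
    show "is_pullback C f g P p q"
      unfolding is_pullback_def
    proof (intro conjI ballI impI)
      fix K u v
      assume K: "K \<in> Obj C" and u: "u \<in> hom C K (Dom C f)" and v: "v \<in> hom C K (Dom C g)"
        and eq: "f \<cdot> u = g \<cdot> v"
      let ?k = "f \<cdot> u"
      have k: "?k \<in> hom C K X"
        using Comp_hom[OF u, of f] homI[of f C] assms by auto
      have ks: "?k \<in> Obj (slice C X)" "(?k, u, f) \<in> hom (slice C X) ?k f"
        "(?k, v, g) \<in> hom (slice C X) ?k g"
        using slice_homI[OF k homI[of f C, unfolded assms(2)] u]
          slice_homI[OF k homI[of g C, unfolded assms(4)] v] k eq assms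
        by (auto simp: Obj_slice hom_Arr hom_Cod)
      then have ex1: "\<exists>!h. h \<in> hom (slice C X) ?k r \<and> (r, p, f) \<cdot>\<^bsub>slice C X\<^esub> h = (?k, u, f) \<and>
          (r, q, g) \<cdot>\<^bsub>slice C X\<^esub> h = (?k, v, g)"
        using prod unfolding is_product_def by blast
      \<comment> \<open>The outer components of a slice arrow are its endpoints, so uniqueness in
        the slice is uniqueness of the middle component.\<close>
      have iff: "(?k, h, r) \<in> hom (slice C X) ?k r \<and> (r, p, f) \<cdot>\<^bsub>slice C X\<^esub> (?k, h, r) = (?k, u, f) \<and>
          (r, q, g) \<cdot>\<^bsub>slice C X\<^esub> (?k, h, r) = (?k, v, g) \<longleftrightarrow>
          h \<in> hom C K P \<and> p \<cdot> h = u \<and> q \<cdot> h = v" for h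
        using k r rh DP by (auto simp: hom_slice hom_Dom hom_Cod hom_Arr)
      from ex1 obtain h' where h': "h' \<in> hom (slice C X) ?k r"
          "(r, p, f) \<cdot>\<^bsub>slice C X\<^esub> h' = (?k, u, f)" "(r, q, g) \<cdot>\<^bsub>slice C X\<^esub> h' = (?k, v, g)"
        by blast
      then obtain h where "h' = (?k, h, r)"
        using hom_slice by metis
      with h' have h: "(?k, h, r) \<in> hom (slice C X) ?k r \<and>
          (r, p, f) \<cdot>\<^bsub>slice C X\<^esub> (?k, h, r) = (?k, u, f) \<and>
          (r, q, g) \<cdot>\<^bsub>slice C X\<^esub> (?k, h, r) = (?k, v, g)"
        by simp
      show "\<exists>!h. h \<in> hom C K P \<and> p \<cdot> h = u \<and> q \<cdot> h = v"
      proof (rule ex1I)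
        show "h \<in> hom C K P \<and> p \<cdot> h = u \<and> q \<cdot> h = v"
          using h iff by blast
        fix h' assume "h' \<in> hom C K P \<and> p \<cdot> h' = u \<and> q \<cdot> h' = v"
        then have "(?k, h', r) = (?k, h, r)"
          using ex1 iff h by metis
        then show "h' = h" by simp
      qed
    qed (use assms PO in auto)
  next
    assume pb: "is_pullback C f g P p q"
    show "is_product (slice C X) f g r (r, p, f) (r, q, g)"
      unfolding is_product_def
    proof (intro conjI ballI proj)
      fix k u' v'
      assume k: "k \<in> Obj (slice C X)" and u': "u' \<in> hom (slice C X) k f"
        and v': "v' \<in> hom (slice C X) k g"
      from u' obtain u where u: "u' = (k, u, f)" "u \<in> hom C (Dom C k) (Dom C f)" "f \<cdot> u = k"
        by (auto simp: hom_slice)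
      from v' obtain v where v: "v' = (k, v, g)" "v \<in> hom C (Dom C k) (Dom C g)" "g \<cdot> v = k"
        by (auto simp: hom_slice)
      have "Dom C k \<in> Obj C"
        using u(2) hom_Obj by blast
      then obtain h where h: "h \<in> hom C (Dom C k) P" "p \<cdot> h = u" "q \<cdot> h = v"
        and uniq: "\<And>h'. h' \<in> hom C (Dom C k) P \<Longrightarrow> p \<cdot> h' = u \<Longrightarrow> q \<cdot> h' = v \<Longrightarrow> h' = h"
        using pb u v unfolding is_pullback_def by metis
      show "\<exists>!h. h \<in> hom (slice C X) k r \<and> (r, p, f) \<cdot>\<^bsub>slice C X\<^esub> h = u' \<and>
          (r, q, g) \<cdot>\<^bsub>slice C X\<^esub> h = v'"
      proof (rule ex1I[of _ "(k, h, r)"])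
        show "(k, h, r) \<in> hom (slice C X) k r \<and> (r, p, f) \<cdot>\<^bsub>slice C X\<^esub> (k, h, r) = u' \<and>
            (r, q, g) \<cdot>\<^bsub>slice C X\<^esub> (k, h, r) = v'"
          using h rh[OF h(1,2)] u v k r DP by (auto simp: hom_slice Obj_slice hom_Arr hom_Cod)
        fix h'' assume "h'' \<in> hom (slice C X) k r \<and> (r, p, f) \<cdot>\<^bsub>slice C X\<^esub> h'' = u' \<and>
            (r, q, g) \<cdot>\<^bsub>slice C X\<^esub> h'' = v'"
        then show "h'' = (k, h, r)"
          using uniq u v DP by (auto simp: hom_slice)
      qed
    qed
  qed
qed

end

text \<open>The arrows 0, 1, 2 are the identities, and 3 and 4 are the two legs; numbered this way,
  composition is the maximum.\<close>

definition cospan :: "(nat, nat) cat" where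
  "cospan = \<lparr>Obj = {0, 1, 2}, Arr = {0, 1, 2, 3, 4},
     Dom = (\<lambda>k. if k = 3 then 0 else if k = 4 then 1 else k),
     Cod = (\<lambda>k. if k = 3 \<or> k = 4 then 2 else k),
     Ident = (\<lambda>k. k), Comp = max\<rparr>"

lemma hom_cospan:
  "k \<in> hom cospan i j \<longleftrightarrow> (k, i, j) \<in> {(0, 0, 0), (1, 1, 1), (2, 2, 2), (3, 0, 2), (4, 1, 2)}"
proof
  assume k: "k \<in> hom cospan i j"
  then have ij: "i = Dom cospan k" "j = Cod cospan k"
    by (simp_all add: hom_def)
  have "k \<in> {0, 1, 2, 3, 4}"
    using hom_Arr[OF k] by (simp add: cospan_def)
  then show "(k, i, j) \<in> {(0, 0, 0), (1, 1, 1), (2, 2, 2), (3, 0, 2), (4, 1, 2)}"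
    unfolding ij by (elim insertE) (simp_all add: cospan_def)
next
  assume "(k, i, j) \<in> {(0, 0, 0), (1, 1, 1), (2, 2, 2), (3, 0, 2), (4, 1, 2)}"
  then show "k \<in> hom cospan i j"
    by (elim insertE) (simp_all add: hom_def cospan_def)
qed

lemma Comp_cospan: "g \<cdot>\<^bsub>cospan\<^esub> f = max g f"
  by (simp add: cospan_def)

lemma category_cospan: "category cospan"
proof
  fix f g h i j k l
  assume f: "f \<in> hom cospan i j"
  then show "f \<cdot>\<^bsub>cospan\<^esub> Ident cospan i = f" "Ident cospan j \<cdot>\<^bsub>cospan\<^esub> f = f"
    unfolding hom_cospan by (auto simp: cospan_def)
  assume g: "g \<in> hom cospan j k"
  with f show "g \<cdot>\<^bsub>cospan\<^esub> f \<in> hom cospan i k"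
    unfolding hom_cospan by (auto simp: cospan_def)
  show "h \<cdot>\<^bsub>cospan\<^esub> g \<cdot>\<^bsub>cospan\<^esub> f = h \<cdot>\<^bsub>cospan\<^esub> (g \<cdot>\<^bsub>cospan\<^esub> f)"
    by (simp add: cospan_def max.assoc)
next
  fix f assume "f \<in> Arr cospan"
  then show "Dom cospan f \<in> Obj cospan" "Cod cospan f \<in> Obj cospan"
    by (auto simp: cospan_def)
next
  fix i assume "i \<in> Obj cospan"
  then show "Ident cospan i \<in> hom cospan i i"
    unfolding hom_cospan by (auto simp: cospan_def)
qed

section \<open>Terminal object, pullbacks and products from finite completeness\<close>

context category
begin

lemma terminal_is_terminal:
  assumes "finitely_complete C"
  shows "is_terminal C (terminal C)"
proof -
  \<comment> \<open>A terminal object is a limit of the empty diagram; with nothing to send, the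
    functor may have undefined values.\<close>
  let ?J = "\<lparr>Obj = {}, Arr = {}, Dom = (\<lambda>k. k), Cod = (\<lambda>k. k), Ident = (\<lambda>k. k),
    Comp = (\<lambda>g f. f)\<rparr> :: (nat, nat) cat"
  let ?F = "\<lparr>fobj = (\<lambda>_. undefined), farr = (\<lambda>_. undefined)\<rparr> :: (nat, nat, 'o, 'a) funct"
  have "category ?J" "is_functor ?J C ?F"
    by (auto simp: category_def is_functor_def hom_def)
  then obtain L \<pi> where "is_limit ?J C ?F L \<pi>"
    using assms unfolding finitely_complete_def by (metis cat.select_convs(1,2) finite.emptyI)
  then have "is_terminal C L"
    by (auto simp: is_limit_def is_cone_def is_terminal_def hom_def)
  then show ?thesis
    unfolding terminal_def by (rule someI)
qed

lemma pullback_exists: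
  assumes "finitely_complete C" and f: "f \<in> hom C A B" and g: "g \<in> hom C A' B"
  shows "\<exists>P p q. is_pullback C f g P p q"
proof -
  \<comment> \<open>Objects 0 and 1 go to the feet and 2 to the common codomain; the last branch of
    \<open>farr\<close> serves arrow 4, the second leg.\<close>
  let ?F = "\<lparr>fobj = (\<lambda>i. if i = 0 then A else if i = 1 then A' else B),
    farr = (\<lambda>k. if k = 0 then Ident C A else if k = 1 then Ident C A'
              else if k = 2 then Ident C B else if k = 3 then f else g)\<rparr>
    :: (nat, nat, 'o, 'a) funct"
  have O: "A \<in> Obj C" "A' \<in> Obj C" "B \<in> Obj C"
    using f g hom_Obj by auto
  have "is_functor cospan C ?F"
    unfolding is_functor_def
  proof (intro conjI allI ballI)
    fix i assume "i \<in> Obj cospan"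
    then show "fobj ?F i \<in> Obj C" "farr ?F (Ident cospan i) = Ident C (fobj ?F i)"
      using O by (auto simp: cospan_def)
  next
    fix i j k assume "k \<in> hom cospan i j"
    then show "farr ?F k \<in> hom C (fobj ?F i) (fobj ?F j)"
      unfolding hom_cospan using O f g by (auto simp: Ident_hom)
    fix l h assume "h \<in> hom cospan j l"
    with \<open>k \<in> hom cospan i j\<close>
    \<comment> \<open>The composable pairs: three of identities, and each leg with the identity at
      either end.\<close>
    have "k = 0 \<and> h = 0 \<or> k = 1 \<and> h = 1 \<or> k = 2 \<and> h = 2 \<or> k = 0 \<and> h = 3 \<or> k = 3 \<and> h = 2 \<or>
        k = 1 \<and> h = 4 \<or> k = 4 \<and> h = 2"
      unfolding hom_cospan by auto
    then show "farr ?F (h \<cdot>\<^bsub>cospan\<^esub> k) = farr ?F h \<cdot> farr ?F k"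
      unfolding Comp_cospan
      using Comp_Ident[OF Ident_hom[OF O(1)]] Comp_Ident[OF Ident_hom[OF O(2)]]
        Comp_Ident[OF Ident_hom[OF O(3)]] Comp_Ident[OF f] Comp_Ident[OF g]
        Ident_Comp[OF f] Ident_Comp[OF g]
      by (elim disjE conjE) auto
  qed
  moreover have "finite (Obj cospan)" "finite (Arr cospan)"
    by (simp_all add: cospan_def)
  ultimately obtain L \<pi> where lim: "is_limit cospan C ?F L \<pi>"
    using assms(1) category_cospan unfolding finitely_complete_def by blast
  \<comment> \<open>The component at 2 is determined by either of the others, so a cone is a
    commuting square.\<close>
  have cone_iff: "is_cone cospan C ?F K \<rho> \<longleftrightarrow> K \<in> Obj C \<and> \<rho> 0 \<in> hom C K A \<and> \<rho> 1 \<in> hom C K A' \<and>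
      \<rho> 2 \<in> hom C K B \<and> f \<cdot> \<rho> 0 = \<rho> 2 \<and> g \<cdot> \<rho> 1 = \<rho> 2" (is "_ \<longleftrightarrow> ?R") for K \<rho>
  proof
    assume cone: "is_cone cospan C ?F K \<rho>"
    have "3 \<in> hom cospan 0 2" "4 \<in> hom cospan 1 2"
      by (simp_all add: hom_cospan)
    with cone have "farr ?F 3 \<cdot> \<rho> 0 = \<rho> 2" "farr ?F 4 \<cdot> \<rho> 1 = \<rho> 2"
      unfolding is_cone_def by blast+
    moreover have "K \<in> Obj C" "\<rho> 0 \<in> hom C K (fobj ?F 0)" "\<rho> 1 \<in> hom C K (fobj ?F 1)"
      "\<rho> 2 \<in> hom C K (fobj ?F 2)"
      using cone unfolding is_cone_def by (auto simp: cospan_def)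
    ultimately show ?R by simp
  next
    assume R: ?R
    show "is_cone cospan C ?F K \<rho>"
      unfolding is_cone_def
    proof (intro conjI allI ballI)
      show "K \<in> Obj C" using R by simp
      fix i assume "i \<in> Obj cospan"
      then show "\<rho> i \<in> hom C K (fobj ?F i)"
        using R by (auto simp: cospan_def)
    next
      fix i j k assume "k \<in> hom cospan i j"
      then have "k = 0 \<and> i = 0 \<and> j = 0 \<or> k = 1 \<and> i = 1 \<and> j = 1 \<or> k = 2 \<and> i = 2 \<and> j = 2 \<or>
          k = 3 \<and> i = 0 \<and> j = 2 \<or> k = 4 \<and> i = 1 \<and> j = 2"
        by (auto simp: hom_cospan)
      then show "farr ?F k \<cdot> \<rho> i = \<rho> j"
        using R Ident_Comp by auto
    qed
  qed
  have lim_cone: "L \<in> Obj C" "\<pi> 0 \<in> hom C L A" "\<pi> 1 \<in> hom C L A'" "f \<cdot> \<pi> 0 = \<pi> 2" "g \<cdot> \<pi> 1 = \<pi> 2"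
    using lim cone_iff unfolding is_limit_def by auto
  have "is_pullback C f g L (\<pi> 0) (\<pi> 1)"
    unfolding is_pullback_def
  proof (intro conjI ballI impI)
    fix K u v
    assume K: "K \<in> Obj C" and "u \<in> hom C K (Dom C f)" "v \<in> hom C K (Dom C g)" and eq: "f \<cdot> u = g \<cdot> v"
    then have u: "u \<in> hom C K A" and v: "v \<in> hom C K A'"
      using f g by (simp_all add: hom_Dom)
    let ?\<rho> = "\<lambda>i :: nat. if i = 0 then u else if i = 1 then v else f \<cdot> u"
    have "is_cone cospan C ?F K ?\<rho>"
      unfolding cone_iff using K u v eq Comp_hom[OF u f] by simp
    then have ex1: "\<exists>!h. h \<in> hom C K L \<and> (\<forall>i \<in> Obj cospan. \<pi> i \<cdot> h = ?\<rho> i)"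
      using lim unfolding is_limit_def by blast
    \<comment> \<open>Compatibility at 2 follows from that at 0, which leaves the two equations of a
      pullback.\<close>
    have "(\<forall>i \<in> Obj cospan. \<pi> i \<cdot> h = ?\<rho> i) \<longleftrightarrow> \<pi> 0 \<cdot> h = u \<and> \<pi> 1 \<cdot> h = v" if "h \<in> hom C K L" for h
      using Comp_assoc[OF that lim_cone(2) f] lim_cone(4) by (auto simp: cospan_def)
    then show "\<exists>!h. h \<in> hom C K L \<and> \<pi> 0 \<cdot> h = u \<and> \<pi> 1 \<cdot> h = v"
      using ex1 by (smt (verit))
  qed (use f g lim_cone in \<open>simp_all add: hom_Arr hom_Dom hom_Cod\<close>)
  then show ?thesis by blast
qed

lemma terminal_hom_unique:
  assumes "is_terminal C T" "f \<in> hom C A T" "g \<in> hom C A T"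
  shows "f = g"
  using assms hom_Obj(1) unfolding is_terminal_def by metis

text \<open>A product is a pullback over the terminal object, where every square commutes.\<close>

lemma product_exists:
  assumes "finitely_complete C" and A: "A \<in> Obj C" and B: "B \<in> Obj C"
  shows "is_product C A B (prod_obj C A B) (pr1 C A B) (pr2 C A B)"
proof -
  note T = terminal_is_terminal[OF assms(1)]
  obtain f g where f: "f \<in> hom C A (terminal C)" and g: "g \<in> hom C B (terminal C)"
    using T A B unfolding is_terminal_def by metis
  obtain P p q where pb: "is_pullback C f g P p q"
    using pullback_exists[OF assms(1) f g] by blast
  have "f \<cdot> u = g \<cdot> v" if "u \<in> hom C K A" "v \<in> hom C K B" for K u v
    by (rule terminal_hom_unique[OF T Comp_hom[OF that(1) f] Comp_hom[OF that(2) g]])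
  then have "is_product C A B P p q"
    using pb f g unfolding is_pullback_def is_product_def by (simp add: hom_Dom)
  then show ?thesis by (rule product_is_product)
qed

text \<open>Some pullback gives a slice product, so the chosen one is a product as well; the
  equivalence with pullbacks is then read backwards on the chosen projections.\<close>

lemma slice_product:
  assumes "finitely_complete C" "f \<in> hom C A X" "g \<in> hom C B X"
  obtains r p q where "prod_obj (slice C X) f g = r" "pr1 (slice C X) f g = (r, p, f)"
    "pr2 (slice C X) f g = (r, q, g)" "is_pullback C f g (Dom C r) p q"
    "is_product (slice C X) f g r (r, p, f) (r, q, g)"
    "p \<in> hom C (Dom C r) A" "q \<in> hom C (Dom C r) B" "f \<cdot> p = r" "g \<cdot> q = r"
proof -
  have f: "f \<in> Arr C" "Cod C f = X" "Dom C f = A" and g: "g \<in> Arr C" "Cod C g = X" "Dom C g = B"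
    using assms by (auto simp: hom_Arr hom_Cod hom_Dom)
  obtain P p q where pb: "is_pullback C f g P p q"
    using pullback_exists[OF assms] by blast
  then have "p \<in> hom C P (Dom C f)" "q \<in> hom C P (Dom C g)" "f \<cdot> p = g \<cdot> q"
    unfolding is_pullback_def by blast+
  then have "is_product (slice C X) f g (f \<cdot> p) (f \<cdot> p, p, f) (f \<cdot> p, q, g)"
    using slice_product_iff_pullback[OF f(1,2) g(1,2)] pb by metis
  then have prod: "is_product (slice C X) f g (prod_obj (slice C X) f g)
      (pr1 (slice C X) f g) (pr2 (slice C X) f g)"
    by (rule category.product_is_product[OF category_slice])
  define r where "r = prod_obj (slice C X) f g"
  have "pr1 (slice C X) f g \<in> hom (slice C X) r f" "pr2 (slice C X) f g \<in> hom (slice C X) r g"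
    using prod unfolding is_product_def r_def by blast+
  then obtain p q where p: "pr1 (slice C X) f g = (r, p, f)" "p \<in> hom C (Dom C r) (Dom C f)" "f \<cdot> p = r"
    and q: "pr2 (slice C X) f g = (r, q, g)" "q \<in> hom C (Dom C r) (Dom C g)" "g \<cdot> q = r"
    unfolding hom_slice by blast
  show thesis
    by (rule that[OF r_def[symmetric] p(1) q(1)])
      (use prod slice_product_iff_pullback[OF f(1,2) g(1,2) p(2) q(2) p(3) q(3)] p q f g
        in \<open>simp_all add: r_def\<close>)
qed

section \<open>The two auxiliary adjunctions\<close>

lemma is_functor_underlying: "is_functor (slice C X) C (underlying C)"
  unfolding is_functor_def
proof (intro conjI allI ballI)
  fix p assume "p \<in> Obj (slice C X)"
  then show "fobj (underlying C) p \<in> Obj C"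
    "farr (underlying C) (Ident (slice C X) p) = Ident C (fobj (underlying C) p)"
    by (auto simp: underlying_def Obj_slice Dom_Obj)
next
  fix f p q assume f: "f \<in> hom (slice C X) p q"
  then show "farr (underlying C) f \<in> hom C (fobj (underlying C) p) (fobj (underlying C) q)"
    by (auto simp: underlying_def hom_slice)
  fix g r assume "g \<in> hom (slice C X) q r"
  with f show "farr (underlying C) (g \<cdot>\<^bsub>slice C X\<^esub> f) = farr (underlying C) g \<cdot> farr (underlying C) f"
    by (auto simp: underlying_def hom_slice)
qed

text \<open>An arrow over X from \<open>p\<close> into the projection of S \<times> X has second
  component \<open>p\<close>, so it amounts to its first component, an arrow from the domain of
  \<open>p\<close> to S.\<close>

lemma adjoint_underlying_times_over:
  assumes "finitely_complete C" and X: "X \<in> Obj C"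
  shows "adjoint (slice C X) C (underlying C) (times_over C X)"
proof -
  note prod = product_exists[OF assms(1) _ X]
  have pr1: "pr1 C A X \<in> hom C (prod_obj C A X) A"
    and pr2: "pr2 C A X \<in> hom C (prod_obj C A X) X" if "A \<in> Obj C" for A
    using prod[OF that] unfolding is_product_def by blast+
  note pair = pairing_props[OF prod]
  \<comment> \<open>Naturality of pairing in its source. Through \<open>map_comp\<close> it gives
    functoriality on composites, and together with \<open>map_comp\<close> the naturality of the
    transposition.\<close>
  have pairing_comp: "pairing C B X (f \<cdot> u) v \<cdot> k = pairing C B X (f \<cdot> (u \<cdot> k)) (v \<cdot> k)"
    if f: "f \<in> hom C A B" and u: "u \<in> hom C K A" and v: "v \<in> hom C K X" and k: "k \<in> hom C L K"
    for f u v k A B K L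
  proof -
    have B: "B \<in> Obj C" using f hom_Obj by blast
    note p = pair[OF B Comp_hom[OF u f] v]
    show ?thesis
      by (rule pairing_eqI[OF prod[OF B] Comp_hom[OF k p(1)], symmetric])
        (use Comp_assoc[OF k p(1) pr1[OF B]] Comp_assoc[OF k p(1) pr2[OF B]] p
            Comp_assoc[OF k u f] Comp_hom[OF Comp_hom[OF k u] f] Comp_hom[OF k v] in simp_all)
  qed
  have map_comp: "pairing C B X (f \<cdot> pr1 C A X) (pr2 C A X) \<cdot> pairing C A X u v = pairing C B X (f \<cdot> u) v"
    if f: "f \<in> hom C A B" and u: "u \<in> hom C K A" and v: "v \<in> hom C K X" for f u v A B K
  proof -
    have A: "A \<in> Obj C" using f hom_Obj by blast
    show ?thesis
      using pairing_comp[OF f pr1[OF A] pr2[OF A] pair(1)[OF A u v]] pair[OF A u v] by simp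
  qed
  let ?T = "times_over C X"
  have T_arr: "farr ?T f = (pr2 C A X, pairing C B X (f \<cdot> pr1 C A X) (pr2 C A X), pr2 C B X)"
    if "f \<in> hom C A B" for f A B
    using that by (simp add: times_over_def hom_Dom hom_Cod)
  have T_functor: "is_functor C (slice C X) ?T"
    unfolding is_functor_def
  proof (intro conjI allI ballI)
    fix A assume A: "A \<in> Obj C"
    then show "fobj ?T A \<in> Obj (slice C X)"
      using pr2[OF A] by (simp add: times_over_def Obj_slice hom_Arr hom_Cod)
    have "pairing C A X (Ident C A \<cdot> pr1 C A X) (pr2 C A X) = Ident C (prod_obj C A X)"
      using pr1[OF A] pr2[OF A] hom_Obj(1)[OF pr1[OF A]] prod[OF A]
      by (intro pairing_eqI[OF prod[OF A] Ident_hom]) (simp_all add: Ident_Comp Comp_Ident)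
    then show "farr ?T (Ident C A) = Ident (slice C X) (fobj ?T A)"
      unfolding T_arr[OF Ident_hom[OF A]] by (simp add: times_over_def hom_Dom[OF pr2[OF A]])
  next
    fix f A B assume f: "f \<in> hom C A B"
    have A: "A \<in> Obj C" and B: "B \<in> Obj C" using f hom_Obj by auto
    note p = pair[OF B Comp_hom[OF pr1[OF A] f] pr2[OF A]]
    show "farr ?T f \<in> hom (slice C X) (fobj ?T A) (fobj ?T B)"
      unfolding T_arr[OF f] using slice_homI[OF pr2[OF A] pr2[OF B] p(1,3)]
      by (simp add: times_over_def)
    fix g D assume g: "g \<in> hom C B D"
    show "farr ?T (g \<cdot> f) = farr ?T g \<cdot>\<^bsub>slice C X\<^esub> farr ?T f"
      using map_comp[OF g Comp_hom[OF pr1[OF A] f] pr2[OF A]]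
      by (simp add: T_arr[OF f] T_arr[OF g] T_arr[OF Comp_hom[OF f g]] Comp_assoc[OF pr1[OF A] f g])
  qed
  \<comment> \<open>Transposition pairs \<open>h\<close> with the structure map \<open>p\<close>;
    composing with the first projection undoes it.\<close>
  let ?\<phi> = "\<lambda>p B h. (p, pairing C B X h p, pr2 C B X)"
  have "bij_betw (?\<phi> p B) (hom C (fobj (underlying C) p) B) (hom (slice C X) p (fobj ?T B))"
    if "p \<in> Obj (slice C X)" and B: "B \<in> Obj C" for p B
  proof (rule bij_betw_byWitness[where f' = "\<lambda>(_, k, _). pr1 C B X \<cdot> k"])
    have p: "p \<in> hom C (Dom C p) X"
      using that homI[of p C] by (auto simp: Obj_slice)
    have fo: "fobj (underlying C) p = Dom C p" "fobj ?T B = pr2 C B X"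
      by (simp_all add: underlying_def times_over_def)
    show "\<forall>h \<in> hom C (fobj (underlying C) p) B. (\<lambda>(_, k, _). pr1 C B X \<cdot> k) (?\<phi> p B h) = h"
      using pair(2)[OF B _ p] by (simp add: fo)
    show "?\<phi> p B ` hom C (fobj (underlying C) p) B \<subseteq> hom (slice C X) p (fobj ?T B)"
      using slice_homI[OF p pr2[OF B] pair(1)[OF B _ p] pair(3)[OF B _ p]] by (auto simp: fo)
    have k: "k \<in> hom C (Dom C p) (prod_obj C B X) \<and> pr2 C B X \<cdot> k = p"
      if "(p, k, pr2 C B X) \<in> hom (slice C X) p (pr2 C B X)" for k
      using that hom_Dom[OF pr2[OF B]] by (auto simp: hom_slice)
    show "\<forall>g \<in> hom (slice C X) p (fobj ?T B). ?\<phi> p B ((\<lambda>(_, k, _). pr1 C B X \<cdot> k) g) = g"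
    proof
      fix g assume g: "g \<in> hom (slice C X) p (fobj ?T B)"
      then obtain l where gl: "g = (p, l, pr2 C B X)"
        unfolding hom_slice fo by blast
      with g have l: "l \<in> hom C (Dom C p) (prod_obj C B X)" "pr2 C B X \<cdot> l = p"
        using k by (auto simp: fo)
      show "?\<phi> p B ((\<lambda>(_, k, _). pr1 C B X \<cdot> k) g) = g"
        using pairing_eqI[OF prod[OF B] l(1) refl l(2) Comp_hom[OF l(1) pr1[OF B]] p] by (simp add: gl)
    qed
    show "(\<lambda>(_, k, _). pr1 C B X \<cdot> k) ` hom (slice C X) p (fobj ?T B) \<subseteq> hom C (fobj (underlying C) p) B"
    proof clarify
      fix p' l q' assume g: "(p', l, q') \<in> hom (slice C X) p (fobj ?T B)"
      then have "p' = p" "q' = pr2 C B X"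
        unfolding hom_slice fo by blast+
      with g have "l \<in> hom C (Dom C p) (prod_obj C B X)"
        using k by (auto simp: fo)
      then show "pr1 C B X \<cdot> l \<in> hom C (fobj (underlying C) p) B"
        using Comp_hom[OF _ pr1[OF B]] by (simp add: fo)
    qed
  qed
  moreover have "?\<phi> p' B' (g \<cdot> h \<cdot> farr (underlying C) f)
      = farr ?T g \<cdot>\<^bsub>slice C X\<^esub> ?\<phi> p B h \<cdot>\<^bsub>slice C X\<^esub> f"
    if f: "f \<in> hom (slice C X) p' p" and g: "g \<in> hom C B B'"
      and h: "h \<in> hom C (fobj (underlying C) p) B" for p p' B B' f g h
  proof -
    obtain k where k: "f = (p', k, p)" "k \<in> hom C (Dom C p') (Dom C p)" "p \<cdot> k = p'"
      and "p \<in> Arr C" "Cod C p = X"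
      using f unfolding hom_slice by blast
    then have p: "p \<in> hom C (Dom C p) X"
      using homI by metis
    have h': "h \<in> hom C (Dom C p) B"
      using h by (simp add: underlying_def)
    have "pairing C B' X (g \<cdot> h \<cdot> k) p' = pairing C B' X (g \<cdot> pr1 C B X) (pr2 C B X) \<cdot> pairing C B X h p \<cdot> k"
      using map_comp[OF g h' p] pairing_comp[OF g h' p k(2)] Comp_assoc[OF k(2) h' g] k(3) by simp
    then show ?thesis
      by (simp add: T_arr[OF g] k(1) underlying_def)
  qed
  ultimately show ?thesis
    unfolding adjoint_def using is_functor_underlying T_functor
    by (intro conjI exI[of _ ?\<phi>] ballI) blast+
qed

text \<open>The left adjoint is assembled from one universal arrow \<open>e A\<close> per object,
  and transposition is precomposition with \<open>e A\<close>.\<close>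

lemma adjoint_inclusion_exists:
  assumes refl: "\<And>A. A \<in> Obj C \<Longrightarrow> \<exists>S e. S \<in> U \<and> e \<in> hom C A S \<and>
      (\<forall>T f. T \<in> U \<longrightarrow> f \<in> hom C A T \<longrightarrow> (\<exists>!g. g \<in> hom C S T \<and> g \<cdot> e = f))"
  shows "\<exists>R. adjoint C (full_subcat C U) R inclusion"
proof -
  let ?U = "full_subcat C U"
  obtain S e where S: "\<And>A. A \<in> Obj C \<Longrightarrow> S A \<in> U" and e: "\<And>A. A \<in> Obj C \<Longrightarrow> e A \<in> hom C A (S A)"
    and univ: "\<And>A T f. A \<in> Obj C \<Longrightarrow> T \<in> U \<Longrightarrow> f \<in> hom C A T \<Longrightarrow> \<exists>!g. g \<in> hom C (S A) T \<and> g \<cdot> e A = f"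
    using refl by metis
  define ext where "ext A T f = (THE g. g \<in> hom C (S A) T \<and> g \<cdot> e A = f)" for A T f
  have ext: "ext A T f \<in> hom C (S A) T" "ext A T f \<cdot> e A = f"
    if "A \<in> Obj C" "T \<in> U" "f \<in> hom C A T" for A T f
    using theI'[OF univ[OF that]] unfolding ext_def by blast+
  have ext_eqI: "ext A T f = g"
    if "A \<in> Obj C" "T \<in> U" "g \<in> hom C (S A) T" "g \<cdot> e A = f" for A T f g
  proof -
    have f: "f \<in> hom C A T"
      using Comp_hom[OF e[OF that(1)] that(3)] that(4) by simp
    show ?thesis
      using univ[OF that(1,2) f] ext[OF that(1,2) f] that(3,4) by blast
  qed
  define R where "R = \<lparr>fobj = S, farr = (\<lambda>f. ext (Dom C f) (S (Cod C f)) (e (Cod C f) \<cdot> f))\<rparr>"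
  have R_obj: "fobj R = S"
    by (simp add: R_def)
  have R_arr: "farr R f = ext A (S B) (e B \<cdot> f)" if "f \<in> hom C A B" for f A B
    using that by (simp add: R_def hom_Dom hom_Cod)
  have R: "farr R f \<in> hom C (S A) (S B)" "farr R f \<cdot> e A = e B \<cdot> f" if f: "f \<in> hom C A B" for f A B
    using ext[OF hom_Obj(1)[OF f] S[OF hom_Obj(2)[OF f]] Comp_hom[OF f e[OF hom_Obj(2)[OF f]]]]
    by (simp_all only: R_arr[OF f])
  have R_functor: "is_functor C ?U R"
    unfolding is_functor_def
  proof (intro conjI allI ballI)
    fix A assume A: "A \<in> Obj C"
    then show "fobj R A \<in> Obj ?U"
      using S[OF A] hom_Obj(2)[OF e[OF A]] by (simp add: R_obj)
    show "farr R (Ident C A) = Ident ?U (fobj R A)"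
      using ext_eqI[OF A S[OF A] Ident_hom[OF hom_Obj(2)[OF e[OF A]]]] R_arr[OF Ident_hom[OF A]]
      by (simp add: R_obj Ident_Comp[OF e[OF A]] Comp_Ident[OF e[OF A]])
  next
    fix f A B assume f: "f \<in> hom C A B"
    have A: "A \<in> Obj C" and B: "B \<in> Obj C" using f hom_Obj by auto
    show "farr R f \<in> hom ?U (fobj R A) (fobj R B)"
      unfolding hom_full_subcat R_obj using R(1)[OF f] S[OF A] S[OF B] by blast
    fix g D assume g: "g \<in> hom C B D"
    have D: "D \<in> Obj C" using g hom_Obj by auto
    \<comment> \<open>Extensions along \<open>e A\<close> are unique, so this equation is all that
      functoriality on composites requires.\<close>
    have "farr R g \<cdot> farr R f \<cdot> e A = e D \<cdot> (g \<cdot> f)"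
      by (simp only: Comp_assoc[OF e[OF A] R(1)[OF f] R(1)[OF g]] R(2)[OF f]
          Comp_assoc[OF f e[OF B] R(1)[OF g], symmetric] R(2)[OF g] Comp_assoc[OF f g e[OF D]])
    from ext_eqI[OF A S[OF D] Comp_hom[OF R(1)[OF f] R(1)[OF g]] this]
    show "farr R (g \<cdot> f) = farr R g \<cdot>\<^bsub>?U\<^esub> farr R f"
      by (simp add: R_arr[OF Comp_hom[OF f g]])
  qed
  have "is_functor ?U C inclusion"
    by (simp add: is_functor_def inclusion_def hom_full_subcat)
  moreover have "bij_betw (\<lambda>h. h \<cdot> e A) (hom ?U (S A) T) (hom C A (fobj inclusion T))"
    if A: "A \<in> Obj C" and T: "T \<in> Obj ?U" for A T
  proof (rule bij_betw_byWitness[where f' = "ext A T"])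
    have T: "T \<in> U" using T by simp
    show "\<forall>h \<in> hom ?U (S A) T. ext A T (h \<cdot> e A) = h"
      using ext_eqI[OF A T] by (simp add: hom_full_subcat)
    show "\<forall>f \<in> hom C A (fobj inclusion T). ext A T f \<cdot> e A = f"
      "ext A T ` hom C A (fobj inclusion T) \<subseteq> hom ?U (S A) T"
      using ext[OF A T] S[OF A] T by (auto simp: inclusion_def hom_full_subcat)
    show "(\<lambda>h. h \<cdot> e A) ` hom ?U (S A) T \<subseteq> hom C A (fobj inclusion T)"
      using Comp_hom[OF e[OF A]] by (auto simp: inclusion_def hom_full_subcat)
  qed
  moreover have "g \<cdot>\<^bsub>?U\<^esub> h \<cdot>\<^bsub>?U\<^esub> farr R f \<cdot> e A' = farr inclusion g \<cdot> (h \<cdot> e A) \<cdot> f"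
    if f: "f \<in> hom C A' A" and "g \<in> hom ?U T T'" and "h \<in> hom ?U (S A) T" for A A' T T' f g h
  proof -
    have g: "g \<in> hom C T T'" and h: "h \<in> hom C (S A) T"
      using that by (simp_all add: hom_full_subcat)
    have A: "A \<in> Obj C" and A': "A' \<in> Obj C" using f hom_Obj by auto
    have gh: "g \<cdot> h \<in> hom C (S A) T'" by (rule Comp_hom[OF h g])
    show ?thesis
      using Comp_assoc[OF e[OF A'] R(1)[OF f] gh] Comp_assoc[OF f e[OF A] gh] R(2)[OF f]
        Comp_assoc[OF e[OF A] h g] by (simp add: inclusion_def)
  qed
  ultimately show ?thesis
    unfolding adjoint_def R_obj[symmetric] using R_functor
    by (intro exI[of _ R] conjI exI[of _ "\<lambda>A T h. h \<cdot> e A"] ballI)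
qed

section \<open>Factorization systems\<close>

lemma
  assumes fs: "factorization_system C E M"
  shows left_class_Arr: "e \<in> E \<Longrightarrow> e \<in> Arr C"
    and right_class_Arr: "m \<in> M \<Longrightarrow> m \<in> Arr C"
    and classes_orthogonal: "e \<in> E \<Longrightarrow> m \<in> M \<Longrightarrow> orthogonal C e m"
    and right_classI: "m \<in> Arr C \<Longrightarrow> (\<And>e. e \<in> E \<Longrightarrow> orthogonal C e m) \<Longrightarrow> m \<in> M"
proof -
  have "E = {e \<in> Arr C. \<forall>m \<in> M. orthogonal C e m}"
    using fs unfolding factorization_system_def by (rule conjunct1)
  note E = eqset_imp_iff[OF this, unfolded mem_Collect_eq]
  have "M = {m \<in> Arr C. \<forall>e \<in> E. orthogonal C e m}"
    using fs unfolding factorization_system_def by (elim conjE)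
  note M = eqset_imp_iff[OF this, unfolded mem_Collect_eq]
  show "e \<in> E \<Longrightarrow> e \<in> Arr C" "e \<in> E \<Longrightarrow> m \<in> M \<Longrightarrow> orthogonal C e m"
    using E[of e] by blast+
  show "m \<in> M \<Longrightarrow> m \<in> Arr C"
    "m \<in> Arr C \<Longrightarrow> (\<And>e. e \<in> E \<Longrightarrow> orthogonal C e m) \<Longrightarrow> m \<in> M"
    using M[of m] by blast+
qed

lemma factorizationE:
  assumes "factorization_system C E M" "f \<in> hom C A B"
  obtains D e m where "e \<in> E" "m \<in> M" "e \<in> hom C A D" "m \<in> hom C D B" "f = m \<cdot> e"
proof -
  have "\<forall>f \<in> Arr C. \<exists>e \<in> E. \<exists>m \<in> M. Cod C e = Dom C m \<and> f = m \<cdot> e"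
    using assms(1) unfolding factorization_system_def by (elim conjE)
  then obtain e m where em: "e \<in> E" "m \<in> M" "Cod C e = Dom C m" "f = m \<cdot> e"
    using hom_Arr[OF assms(2)] by blast
  have e: "e \<in> hom C (Dom C e) (Dom C m)" and m: "m \<in> hom C (Dom C m) (Cod C m)"
    using homI[OF left_class_Arr[OF assms(1) em(1)]] homI[OF right_class_Arr[OF assms(1) em(2)]] em(3)
    by simp_all
  have "Dom C e = A" "Cod C m = B"
    using Comp_hom[OF e m] assms(2) em(4) by (auto simp: hom_def)
  with e m em show thesis
    using that by blast
qed

text \<open>Pasting the pullback square turns a lifting problem against \<open>q\<close> into one
  against \<open>m\<close>. The lift found there and the lower edge \<open>v\<close> form a cone,
  which induces the lift against \<open>q\<close>.\<close>

lemma right_class_pullback_stable: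
  assumes fs: "factorization_system C E M" and m: "m \<in> M" and pb: "is_pullback C m f P p q"
  shows "q \<in> M"
proof -
  have q: "q \<in> hom C P (Dom C f)" and p: "p \<in> hom C P (Dom C m)" and sq: "m \<cdot> p = f \<cdot> q"
    and mf: "m \<in> hom C (Dom C m) (Cod C f)" "f \<in> hom C (Dom C f) (Cod C f)"
    using pb homI[of m C] homI[of f C] unfolding is_pullback_def by simp_all
  have univ: "\<exists>!h. h \<in> hom C K P \<and> p \<cdot> h = u \<and> q \<cdot> h = v"
    if "u \<in> hom C K (Dom C m)" "v \<in> hom C K (Dom C f)" "m \<cdot> u = f \<cdot> v" for K u v
    using pb hom_Obj(1)[OF that(1)] that unfolding is_pullback_def by blast
  have "orthogonal C e q" if "e \<in> E" for e
    unfolding orthogonal_def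
  proof (intro ballI impI)
    fix u v assume "u \<in> hom C (Dom C e) (Dom C q)" and "v \<in> hom C (Cod C e) (Cod C q)"
      and eq: "q \<cdot> u = v \<cdot> e"
    then have u: "u \<in> hom C (Dom C e) P" and v: "v \<in> hom C (Cod C e) (Dom C f)"
      using q by (simp_all add: hom_Dom hom_Cod)
    have e: "e \<in> hom C (Dom C e) (Cod C e)"
      by (rule homI[OF left_class_Arr[OF fs that]])
    have orth: "orthogonal C e m"
      by (rule classes_orthogonal[OF fs that m])
    have pu: "p \<cdot> u \<in> hom C (Dom C e) (Dom C m)" and fv: "f \<cdot> v \<in> hom C (Cod C e) (Cod C m)"
      using Comp_hom[OF u p] Comp_hom[OF v mf(2)] mf(1) by (simp_all add: hom_Cod)
    have "m \<cdot> (p \<cdot> u) = f \<cdot> v \<cdot> e"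
      using Comp_assoc[OF u p mf(1)] Comp_assoc[OF u q mf(2)] Comp_assoc[OF e v mf(2)] sq eq by simp
    then have "\<exists>!d. d \<in> hom C (Cod C e) (Dom C m) \<and> d \<cdot> e = p \<cdot> u \<and> m \<cdot> d = f \<cdot> v"
      using orth pu fv unfolding orthogonal_def by blast
    then obtain d where d: "d \<in> hom C (Cod C e) (Dom C m)" "d \<cdot> e = p \<cdot> u" "m \<cdot> d = f \<cdot> v"
      and d_unique: "\<And>d'. d' \<in> hom C (Cod C e) (Dom C m) \<Longrightarrow> d' \<cdot> e = p \<cdot> u \<Longrightarrow> m \<cdot> d' = f \<cdot> v \<Longrightarrow> d' = d"
      by blast
    obtain h where h: "h \<in> hom C (Cod C e) P" "p \<cdot> h = d" "q \<cdot> h = v"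
      and h_unique: "\<And>h'. h' \<in> hom C (Cod C e) P \<Longrightarrow> p \<cdot> h' = d \<Longrightarrow> q \<cdot> h' = v \<Longrightarrow> h' = h"
      using univ[OF d(1) v d(3)] by blast
    \<comment> \<open>Arrows into \<open>P\<close> are separated by \<open>p\<close> and
      \<open>q\<close>, which forces the upper triangle.\<close>
    have "\<exists>!k. k \<in> hom C (Dom C e) P \<and> p \<cdot> k = p \<cdot> u \<and> q \<cdot> k = q \<cdot> u"
    proof (rule univ[OF pu Comp_hom[OF u q]])
      show "m \<cdot> (p \<cdot> u) = f \<cdot> (q \<cdot> u)"
        using Comp_assoc[OF u p mf(1)] Comp_assoc[OF u q mf(2)] sq by simp
    qed
    moreover have "h \<cdot> e \<in> hom C (Dom C e) P" "p \<cdot> (h \<cdot> e) = p \<cdot> u" "q \<cdot> (h \<cdot> e) = q \<cdot> u"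
      using Comp_hom[OF e h(1)] Comp_assoc[OF e h(1) p] Comp_assoc[OF e h(1) q] h d(2) eq by simp_all
    ultimately have he: "h \<cdot> e = u"
      using u by blast
    show "\<exists>!d. d \<in> hom C (Cod C e) (Dom C q) \<and> d \<cdot> e = u \<and> q \<cdot> d = v"
    proof (rule ex1I[of _ h])
      show "h \<in> hom C (Cod C e) (Dom C q) \<and> h \<cdot> e = u \<and> q \<cdot> h = v"
        using h he q by (simp add: hom_Dom)
      fix k assume "k \<in> hom C (Cod C e) (Dom C q) \<and> k \<cdot> e = u \<and> q \<cdot> k = v"
      then have k: "k \<in> hom C (Cod C e) P" "k \<cdot> e = u" "q \<cdot> k = v"
        using q by (simp_all add: hom_Dom)
      \<comment> \<open>For any other lift \<open>k\<close>, its composite with \<open>p\<close>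
        solves the problem against \<open>m\<close>, so both components of \<open>k\<close> are
        determined.\<close>
      have "p \<cdot> k = d"
        using Comp_assoc[OF e k(1) p] Comp_assoc[OF k(1) p mf(1)] Comp_assoc[OF k(1) q mf(2)] k sq
        by (intro d_unique[OF Comp_hom[OF k(1) p]]) simp_all
      then show "k = h" using h_unique k by blast
    qed
  qed
  then show ?thesis
    by (rule right_classI[OF fs hom_Arr[OF q]])
qed

text \<open>Over a terminal object the square and the lower triangle commute automatically, so
  orthogonality becomes unique extension along \<open>e\<close>. This serves both the reflection
  onto internal sets and the transposition of lifting problems.\<close>

lemma orthogonal_terminal_ex1:
  assumes T: "is_terminal C T" and e: "e \<in> hom C A B" and m: "m \<in> hom C S T"
    and orth: "orthogonal C e m" and u: "u \<in> hom C A S"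
  shows "\<exists>!d. d \<in> hom C B S \<and> d \<cdot> e = u"
proof -
  obtain v where v: "v \<in> hom C B T"
    using T hom_Obj(2)[OF e] unfolding is_terminal_def by blast
  have "m \<cdot> u = v \<cdot> e"
    by (rule terminal_hom_unique[OF T Comp_hom[OF u m] Comp_hom[OF e v]])
  then have "\<exists>!d. d \<in> hom C B S \<and> d \<cdot> e = u \<and> m \<cdot> d = v"
    using orth u v e m unfolding orthogonal_def by (simp add: hom_Dom hom_Cod)
  moreover have "m \<cdot> d = v" if "d \<in> hom C B S" for d
    by (rule terminal_hom_unique[OF T Comp_hom[OF that m] v])
  ultimately show ?thesis by metis
qed

text \<open>Factor the map from A to 1: the middle object is the reflection of A and the E-part is
  its unit, universal because E is orthogonal to every map S \<rightarrow> 1 in M.\<close>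

lemma adjoint_pi0:
  assumes "finitely_complete C" and fs: "factorization_system C E M"
  shows "adjoint C (internal_sets C M) (pi0 C M) inclusion"
proof -
  note T = terminal_is_terminal[OF assms(1)]
  have "\<exists>R. adjoint C (internal_sets C M) R inclusion"
    unfolding internal_sets_def
  proof (rule adjoint_inclusion_exists)
    fix A assume "A \<in> Obj C"
    then obtain t where t: "t \<in> hom C A (terminal C)"
      using T unfolding is_terminal_def by blast
    obtain D e m where em: "e \<in> E" "m \<in> M" and e: "e \<in> hom C A D" and m: "m \<in> hom C D (terminal C)"
      by (rule factorizationE[OF fs t])
    have "\<exists>!g. g \<in> hom C D B \<and> g \<cdot> e = f"
      if B: "B \<in> {S. \<exists>f \<in> hom C S (terminal C). f \<in> M}" and f: "f \<in> hom C A B" for B f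
    proof -
      obtain n where n: "n \<in> hom C B (terminal C)" "n \<in> M"
        using B by blast
      have "orthogonal C e n"
        by (rule classes_orthogonal[OF fs em(1) n(2)])
      from orthogonal_terminal_ex1[OF T e n(1) this f] show ?thesis .
    qed
    then show "\<exists>S e. S \<in> {S. \<exists>f \<in> hom C S (terminal C). f \<in> M} \<and> e \<in> hom C A S \<and>
      (\<forall>T f. T \<in> {S. \<exists>f \<in> hom C S (terminal C). f \<in> M} \<longrightarrow> f \<in> hom C A T \<longrightarrow>
        (\<exists>!g. g \<in> hom C S T \<and> g \<cdot> e = f))"
      using e m em(2) by (intro exI[of _ D] exI[of _ e] conjI allI impI) auto
  qed
  then show ?thesis
    unfolding pi0_def by (rule someI_ex)
qed

section \<open>Complements\<close>

lemma adjoint_power: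
  assumes "exponentiable C A"
  shows "adjoint C C (product_functor C A) (power_functor C A)"
  using assms unfolding exponentiable_def power_functor_def by (metis someI_ex)

lemma adjoint_slice_product_power:
  assumes "finitely_complete C" "X \<in> Obj C" "exponentiable (slice C X) p"
  shows "adjoint (slice C X) C (underlying C \<circ>\<^sub>F product_functor (slice C X) p)
    (power_functor (slice C X) p \<circ>\<^sub>F times_over C X)"
  using assms category.adjoint_power[OF category_slice] adjoint_underlying_times_over
  by (intro adjoint_fcomp) auto

text \<open>The factor \<open>inclusion\<close> of the complement is the right adjoint of
  \<open>pi0\<close>. Here \<open>p\<close> may come from either class, so both halves of the
  theorem take their adjunction from this lemma.\<close>

lemma adjoint_ten_complement:
  assumes "finitely_complete C" "factorization_system C E M" "X \<in> Obj C" "exponentiable (slice C X) p"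
  shows "adjoint (slice C X) (internal_sets C M) (ten C M X p) (complement C X p)"
  using adjoint_fcomp[OF adjoint_slice_product_power[OF assms(1,3,4)] adjoint_pi0[OF assms(1,2)]]
  unfolding ten_def complement_def by (simp add: fcomp_assoc)

end

section \<open>Duality and complements in a balanced factorization category\<close>

context balanced_factorization_category
begin

lemma swap: "balanced_factorization_category C E' M' E M"
proof
  show "e \<in> E' \<Longrightarrow> f \<in> M \<Longrightarrow> is_pullback C e f P p q \<Longrightarrow> q \<in> E'"
    "e \<in> E \<Longrightarrow> f \<in> M' \<Longrightarrow> is_pullback C e f P p q \<Longrightarrow> q \<in> E" for e f P p q
    by (rule pullback_E', assumption+) (rule pullback_E, assumption+)
qed (rule complete fact fact' same_internal_sets[symmetric])+

lemma internal_sets_eq: "internal_sets C M = internal_sets C M'"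
proof -
  let ?U = "\<lambda>M. {S. \<exists>f \<in> hom C S (terminal C). f \<in> M}"
  have "Obj C \<inter> ?U M = ?U M" for M
    using hom_Obj(1) by blast
  then have "?U M = ?U M'"
    using same_internal_sets unfolding internal_sets_def full_subcat_def by simp
  then show ?thesis
    by (simp add: internal_sets_def)
qed

text \<open>Pullback cancellation: the two products are pullbacks of \<open>m\<close> along
  \<open>v\<close> and along \<open>v \<cdot> e\<close>, so the map between them is the pullback of
  \<open>e\<close> along the projection \<open>b\<close>. As \<open>b\<close> lies opposite
  \<open>m\<close>, it is in M, and stability of E' applies.\<close>

lemma product_with_discrete_fibration_E':
  assumes m: "m \<in> M" "m \<in> hom C A X" and v: "v \<in> hom C B X" and e: "e \<in> E'" "e \<in> hom C A' B"
  shows "farr (underlying C \<circ>\<^sub>F product_functor (slice C X) m) (v \<cdot> e, e, v) \<in> E'"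
proof -
  let ?w = "v \<cdot> e"
  have w: "?w \<in> hom C A' X" by (rule Comp_hom[OF e(2) v])
  obtain r a b where r: "prod_obj (slice C X) m v = r" "pr1 (slice C X) m v = (r, a, m)"
    "pr2 (slice C X) m v = (r, b, v)" and pb: "is_pullback C m v (Dom C r) a b"
    and prod: "is_product (slice C X) m v r (r, a, m) (r, b, v)"
    and ab: "a \<in> hom C (Dom C r) A" "b \<in> hom C (Dom C r) B" "m \<cdot> a = r" "v \<cdot> b = r"
    by (rule slice_product[OF complete m(2) v])
  obtain r' a' b' where r': "prod_obj (slice C X) m ?w = r'" "pr1 (slice C X) m ?w = (r', a', m)"
    "pr2 (slice C X) m ?w = (r', b', ?w)" and pb': "is_pullback C m ?w (Dom C r') a' b'"
    and ab': "a' \<in> hom C (Dom C r') A" "b' \<in> hom C (Dom C r') A'" "m \<cdot> a' = r'" "?w \<cdot> b' = r'"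
    by (rule slice_product[OF complete m(2) w])
  have rX: "r' \<in> hom C (Dom C r') X"
    using Comp_hom[OF ab'(1) m(2)] ab'(3) by simp
  define k where "k = farr (underlying C \<circ>\<^sub>F product_functor (slice C X) m) (?w, e, v)"
  \<comment> \<open>The functor \<open>m \<times> -\<close> sends \<open>e\<close> to the pairing of
    \<open>a'\<close> with \<open>e \<cdot> b'\<close>.\<close>
  have k: "k \<in> hom C (Dom C r') (Dom C r)" "a \<cdot> k = a'" "b \<cdot> k = e \<cdot> b'"
  proof -
    have v_eb': "v \<cdot> (e \<cdot> b') = r'"
      using Comp_assoc[OF ab'(2) e(2) v] ab'(4) by simp
    have u1: "(r', a', m) \<in> hom (slice C X) r' m"
      by (rule slice_homI[OF rX m(2) ab'(1) ab'(3)])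
    have u2: "(r', e \<cdot> b', v) \<in> hom (slice C X) r' v"
      by (rule slice_homI[OF rX v Comp_hom[OF ab'(2) e(2)] v_eb'])
    let ?p = "pairing (slice C X) m v (r', a', m) (r', e \<cdot> b', v)"
    have p: "?p \<in> hom (slice C X) r' r" "(r, a, m) \<cdot>\<^bsub>slice C X\<^esub> ?p = (r', a', m)"
      "(r, b, v) \<cdot>\<^bsub>slice C X\<^esub> ?p = (r', e \<cdot> b', v)"
      using category.pairing_props[OF category_slice prod[folded r(1) r(2) r(3)] u1 u2] unfolding r
      by blast+
    then obtain l where l: "?p = (r', l, r)" "l \<in> hom C (Dom C r') (Dom C r)"
      unfolding hom_slice by blast
    have "k = l"
      unfolding k_def using l(1) r'
      by (simp add: fcomp_def underlying_def product_functor_def slice_def)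
    with l p show "k \<in> hom C (Dom C r') (Dom C r)" "a \<cdot> k = a'" "b \<cdot> k = e \<cdot> b'"
      by simp_all
  qed
  have "is_pullback C e b (Dom C r') b' k"
    unfolding is_pullback_def
  proof (intro conjI ballI impI)
    fix K u w
    assume "K \<in> Obj C" and "u \<in> hom C K (Dom C e)" and "w \<in> hom C K (Dom C b)" and eq: "e \<cdot> u = b \<cdot> w"
    then have u: "u \<in> hom C K A'" and w': "w \<in> hom C K (Dom C r)"
      using e ab by (simp_all add: hom_Dom)
    have "m \<cdot> (a \<cdot> w) = ?w \<cdot> u"
      using Comp_assoc[OF w' ab(1) m(2)] Comp_assoc[OF w' ab(2) v] Comp_assoc[OF u e(2) v] ab(3,4) eq by simp
    then have "\<exists>!h. h \<in> hom C K (Dom C r') \<and> a' \<cdot> h = a \<cdot> w \<and> b' \<cdot> h = u"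
      using pb' \<open>K \<in> Obj C\<close> Comp_hom[OF w' ab(1)] u
      unfolding is_pullback_def by (simp add: hom_Dom[OF m(2)] hom_Dom[OF w])
    \<comment> \<open>Once \<open>b' \<cdot> h = u\<close>, the arrows \<open>k \<cdot> h\<close>
      and \<open>w\<close> agree after \<open>b\<close>; since \<open>a\<close> and \<open>b\<close>
      jointly separate arrows, agreement after \<open>a\<close> is what remains.\<close>
    moreover have "a' \<cdot> h = a \<cdot> w \<longleftrightarrow> k \<cdot> h = w" if h: "h \<in> hom C K (Dom C r')" and bh: "b' \<cdot> h = u" for h
    proof
      assume ah: "a' \<cdot> h = a \<cdot> w"
      have kh: "k \<cdot> h \<in> hom C K (Dom C r)" "a \<cdot> (k \<cdot> h) = a \<cdot> w" "b \<cdot> (k \<cdot> h) = b \<cdot> w"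
        using Comp_hom[OF h k(1)] Comp_assoc[OF h k(1) ab(1)] Comp_assoc[OF h k(1) ab(2)]
          Comp_assoc[OF h ab'(2) e(2)] k ah bh eq by simp_all
      have "m \<cdot> (a \<cdot> w) = v \<cdot> (b \<cdot> w)"
        using Comp_assoc[OF w' ab(1) m(2)] Comp_assoc[OF w' ab(2) v] ab(3,4) by simp
      then have "\<exists>!h. h \<in> hom C K (Dom C r) \<and> a \<cdot> h = a \<cdot> w \<and> b \<cdot> h = b \<cdot> w"
        using pb \<open>K \<in> Obj C\<close> Comp_hom[OF w' ab(1)] Comp_hom[OF w' ab(2)]
        unfolding is_pullback_def by (simp add: hom_Dom[OF m(2)] hom_Dom[OF v])
      then show "k \<cdot> h = w" using kh w' by blast
    next
      assume "k \<cdot> h = w"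
      then show "a' \<cdot> h = a \<cdot> w"
        using Comp_assoc[OF h k(1) ab(1)] k(2) by simp
    qed
    ultimately show "\<exists>!h. h \<in> hom C K (Dom C r') \<and> b' \<cdot> h = u \<and> k \<cdot> h = w"
      by metis
  qed (use e ab ab' k hom_Obj(1)[OF rX] in \<open>simp_all add: hom_Arr hom_Dom hom_Cod\<close>)
  moreover have "b \<in> M"
    by (rule right_class_pullback_stable[OF fact m(1) pb])
  ultimately show ?thesis
    unfolding k_def[symmetric] using pullback_E'[OF e(1)] by blast
qed

lemma complement_discrete_opfibration:
  assumes X: "X \<in> Obj C" and m: "m \<in> Obj (over C M X)" and exp: "exponentiable (slice C X) m"
    and S: "S \<in> Obj (internal_sets C M)"
  shows "fobj (complement C X m) S \<in> Obj (over C M' X)"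
proof -
  let ?L = "underlying C \<circ>\<^sub>F product_functor (slice C X) m"
  let ?R = "power_functor (slice C X) m \<circ>\<^sub>F times_over C X"
  note adj = adjoint_slice_product_power[OF complete X exp]
  note T = terminal_is_terminal[OF complete]
  define r where "r = fobj ?R S"
  have compl: "fobj (complement C X m) S = r"
    by (simp add: r_def complement_def fcomp_def inclusion_def)
  \<comment> \<open>S is an internal set by way of M; the coincidence of the internal sets supplies
    a map to 1 in M', which E' can be tested against.\<close>
  obtain t where t: "t \<in> hom C S (terminal C)" "t \<in> M'"
    using S unfolding internal_sets_eq by (auto simp: internal_sets_def)
  have SO: "S \<in> Obj C" by (rule hom_Obj(1)[OF t(1)])
  have L: "is_functor (slice C X) C ?L" and R: "is_functor C (slice C X) ?R"
    using adj unfolding adjoint_def by blast+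
  have "r \<in> Obj (slice C X)"
    using R SO unfolding is_functor_def r_def by blast
  then have r_Arr: "r \<in> Arr C" "Cod C r = X" and r: "r \<in> hom C (Dom C r) X"
    using homI[of r C] by (auto simp: Obj_slice)
  have m': "m \<in> M" "m \<in> hom C (Dom C m) X"
    using m homI[of m C] by (auto simp: Obj_over)
  have "orthogonal C e r" if e: "e \<in> E'" for e
    unfolding orthogonal_def
  proof (intro ballI impI)
    fix u v assume u: "u \<in> hom C (Dom C e) (Dom C r)" and "v \<in> hom C (Cod C e) (Cod C r)"
      and eq: "r \<cdot> u = v \<cdot> e"
    then have v: "v \<in> hom C (Cod C e) X" by (simp add: r_Arr)
    have e': "e \<in> hom C (Dom C e) (Cod C e)"
      by (rule homI[OF left_class_Arr[OF fact' e]])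
    have w: "v \<cdot> e \<in> hom C (Dom C e) X" by (rule Comp_hom[OF e' v])
    \<comment> \<open>The lower edge \<open>v\<close> makes \<open>e\<close> an arrow of C/X, which
      moves the lifting problem into the slice.\<close>
    let ?e = "(v \<cdot> e, e, v)"
    have e_slice: "?e \<in> hom (slice C X) (v \<cdot> e) v"
      by (rule slice_homI[OF w v e' refl])
    have k: "farr ?L ?e \<in> hom C (fobj ?L (v \<cdot> e)) (fobj ?L v)"
      using L e_slice unfolding is_functor_def by blast
    have "orthogonal C (farr ?L ?e) t"
      by (rule classes_orthogonal[OF fact' product_with_discrete_fibration_E'[OF m' v e e'] t(2)])
    note ex1 = orthogonal_terminal_ex1[OF T k t(1) this]
    \<comment> \<open>Unique extension along the product map, split into injectivity and
      surjectivity of precomposition.\<close>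
    have "bij_betw (\<lambda>h. h \<cdot> farr ?L ?e) (hom C (fobj ?L v) S) (hom C (fobj ?L (v \<cdot> e)) S)"
    proof (rule bij_betwI')
      fix h h' assume h: "h \<in> hom C (fobj ?L v) S" "h' \<in> hom C (fobj ?L v) S"
      show "(h \<cdot> farr ?L ?e = h' \<cdot> farr ?L ?e) = (h = h')"
        using ex1[OF Comp_hom[OF k h(1)]] h by metis
    next
      fix h assume "h \<in> hom C (fobj ?L v) S"
      then show "h \<cdot> farr ?L ?e \<in> hom C (fobj ?L (v \<cdot> e)) S" by (rule Comp_hom[OF k])
    next
      fix g assume "g \<in> hom C (fobj ?L (v \<cdot> e)) S"
      from ex1[OF this] show "\<exists>h \<in> hom C (fobj ?L v) S. g = h \<cdot> farr ?L ?e" by blast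
    qed
    then have bij: "bij_betw (\<lambda>h. h \<cdot>\<^bsub>slice C X\<^esub> ?e) (hom (slice C X) v r) (hom (slice C X) (v \<cdot> e) r)"
      unfolding r_def
      by (rule adjoint_precomp_bij[OF category_slice category_axioms adj e_slice SO])
    have hom_v: "(v, d, r) \<in> hom (slice C X) v r \<longleftrightarrow> d \<in> hom C (Cod C e) (Dom C r) \<and> r \<cdot> d = v" for d
      using hom_Arr[OF v] hom_Cod[OF v] hom_Dom[OF v] r_Arr by (simp add: hom_slice)
    \<comment> \<open>The upper edge is an arrow of the slice, and its preimage under the bijection
      is the filler.\<close>
    have "(v \<cdot> e, u, r) \<in> hom (slice C X) (v \<cdot> e) r"
      by (rule slice_homI[OF w r u eq])
    then obtain d' where d': "d' \<in> hom (slice C X) v r" "d' \<cdot>\<^bsub>slice C X\<^esub> ?e = (v \<cdot> e, u, r)"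
      using bij unfolding bij_betw_def by (metis (no_types, lifting) imageE)
    then obtain d where d_eq: "d' = (v, d, r)"
      unfolding hom_slice by blast
    show "\<exists>!d. d \<in> hom C (Cod C e) (Dom C r) \<and> d \<cdot> e = u \<and> r \<cdot> d = v"
    proof (rule ex1I[of _ d])
      show "d \<in> hom C (Cod C e) (Dom C r) \<and> d \<cdot> e = u \<and> r \<cdot> d = v"
        using d' hom_v by (simp add: d_eq)
      fix c assume "c \<in> hom C (Cod C e) (Dom C r) \<and> c \<cdot> e = u \<and> r \<cdot> c = v"
      then have "(v, c, r) \<in> hom (slice C X) v r" "(v, c, r) \<cdot>\<^bsub>slice C X\<^esub> ?e = d' \<cdot>\<^bsub>slice C X\<^esub> ?e"
        using hom_v d'(2) by simp_all
      then have "(v, c, r) = d'"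
        using bij d'(1) unfolding bij_betw_def by (blast dest: inj_onD)
      then show "c = d" by (simp add: d_eq)
    qed
  qed
  then have "r \<in> M'"
    by (rule right_classI[OF fact' r_Arr(1)])
  then show ?thesis
    unfolding compl by (simp add: Obj_over r_Arr)
qed

end

theorem mainTheorem9:
  fixes C :: "('o, 'a) cat" and E M E' M' :: "'a set" and X :: 'o
  assumes "balanced_factorization_category C E M E' M'"
    and "\<forall>Y \<in> Obj C. \<forall>p \<in> Obj (over C M Y) \<union> Obj (over C M' Y). exponentiable (slice C Y) p"
    and "X \<in> Obj C"
  shows "(\<forall>m \<in> Obj (over C M X).
            adjoint (slice C X) (internal_sets C M) (ten C M X m) (complement C X m) \<and>
            (\<forall>S \<in> Obj (internal_sets C M). fobj (complement C X m) S \<in> Obj (over C M' X))) \<and>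
         (\<forall>n \<in> Obj (over C M' X).
            adjoint (slice C X) (internal_sets C M) (ten C M X n) (complement C X n) \<and>
            (\<forall>S \<in> Obj (internal_sets C M). fobj (complement C X n) S \<in> Obj (over C M X)))"
proof -
  interpret balanced_factorization_category C E M E' M' by fact
  interpret swapped: balanced_factorization_category C E' M' E M by (rule swap)
  have exp: "exponentiable (slice C X) p" if "p \<in> Obj (over C M X) \<union> Obj (over C M' X)" for p
    using assms(2,3) that by blast
  show ?thesis
  proof (intro conjI ballI)
    fix p assume p: "p \<in> Obj (over C M X)"
    show "adjoint (slice C X) (internal_sets C M) (ten C M X p) (complement C X p)"
      using p by (intro adjoint_ten_complement[OF complete fact] assms(3) exp UnI1)
    fix S assume "S \<in> Obj (internal_sets C M)"
    with p show "fobj (complement C X p) S \<in> Obj (over C M' X)"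
      by (intro complement_discrete_opfibration assms(3) exp UnI1)
  next
    fix p assume p: "p \<in> Obj (over C M' X)"
    \<comment> \<open>\<open>ten\<close> is still formed with the reflection of the first system, so
      the adjunction is taken from (E, M) and not from the interchanged category.\<close>
    show "adjoint (slice C X) (internal_sets C M) (ten C M X p) (complement C X p)"
      using p by (intro adjoint_ten_complement[OF complete fact] assms(3) exp UnI2)
    fix S assume "S \<in> Obj (internal_sets C M)"
    with p show "fobj (complement C X p) S \<in> Obj (over C M X)"
      \<comment> \<open>The interchanged membership result speaks of internal sets formed from
        M'.\<close>
      unfolding internal_sets_eq
      by (intro swapped.complement_discrete_opfibration assms(3) exp UnI2)
  qed
qed

end
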